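(* Let $d$ be an odd positive integer, $n$ a non-negative integer, and $\rho$ a density matrix over $\mathcal{H} = (\mathbb{C}^d)^{\otimes n}$. Let $(S,q_\rho,\lambda)$ be a set of NC value assignments for $\rho$. For every context $C = \{T_{\mathbf{a_1}},\dots,T_{\mathbf{a_m}}\}\in\mathcal{C}$, every $\nu\in S$ and every $\mathbf{s}\in\mathbb{Z}_d^m$, define $$p_C(\mathbf{s}|\nu) = \frac{1}{|M_{\mathbf{a}}|}\sum_{\mathbf{u}\in M_{\mathbf{a}}}\omega^{-\ell_{\mathbf{s}}(\mathbf{u})}\,\lambda_\nu(\mathbf{u})$$ if the linear form $\ell_{\mathbf{s}}$ on $M_{\mathbf{a}}$ is well defined, and $p_C(\mathbf{s}|\nu) = 0$ otherwise. Then $(S,q_\rho,p)$, with $p = (p_C)_{C\in\mathcal{C}}$, is a deterministic non-contextual hidden variable model for $\rho$.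
   Context: $\mathbb{Z}_d$ is the ring of integers modulo $d$ ($2$ is invertible), $\omega = e^{2i\pi/d}$, $U_d = \{\omega^s \mid s \in \mathbb{Z}_d\}$. Let $(|a\rangle)_{a\in\mathbb{Z}_d}$ be an orthonormal basis of $\mathbb{C}^d$. For $\mathbf{a},\mathbf{b}\in\mathbb{Z}_d^n$, $(\mathbf{a}|\mathbf{b}) = \sum_{i=1}^n a_i b_i$. Vectors of $V = \mathbb{Z}_d^n \times \mathbb{Z}_d^n$ are written $\mathbf{u} = (\mathbf{u_Z},\mathbf{u_X})$, and $[\mathbf{u},\mathbf{v}] = (\mathbf{u_Z}|\mathbf{v_X}) - (\mathbf{u_X}|\mathbf{v_Z}) \in \mathbb{Z}_d$. Pauli matrices: $X|a\rangle = |a+1\rangle$, $Z|a\rangle = \omega^a|a\rangle$; $Z^{\mathbf{a}} = Z^{a_1}\otimes\cdots\otimes Z^{a_n}$, $X^{\mathbf{a}} = X^{a_1}\otimes\cdots\otimes X^{a_n}$. Heisenberg-Weyl operators: $T_{\mathbf{u}} = \omega^{-(\mathbf{u_Z}|\mathbf{u_X})/2} Z^{\mathbf{u_Z}}X^{\mathbf{u_X}}$, $\mathbf{u}\in V$ (division by $2$ in $\mathbb{Z}_d$). $T_{\mathbf{u}}$ and $T_{\mathbf{v}}$ commute if and only if $[\mathbf{u},\mathbf{v}]=0$. Set of NC value assignments for $\rho$: a triple $(S,q_\rho,\lambda)$ where $S$ is a finite set, $q_\rho$ is a probability distribution over $S$, and $\lambda$ is a collection of maps $\lambda_\nu : V\to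 U_d$, $\nu\in S$, such that (1) for all $\nu\in S$, $\mathbf{u},\mathbf{v}\in V$, $[\mathbf{u},\mathbf{v}]=0$ implies $\lambda_\nu(\mathbf{u}+\mathbf{v}) = \lambda_\nu(\mathbf{u})\lambda_\nu(\mathbf{v})$; (2) for all $\mathbf{u}\in V$, $\operatorname{Tr}(T_{\mathbf{u}}\rho) = \sum_{\nu\in S}\lambda_\nu(\mathbf{u})\,q_\rho(\nu)$. Contexts: a context is an ordered tuple $C = \{T_{\mathbf{a_1}},\dots,T_{\mathbf{a_m}}\}$ of pairwise commuting Heisenberg-Weyl operators; $|C| = m$ and $\mathcal{C}$ is the set of all contexts. For $\mathbf{s}\in\mathbb{Z}_d^m$, $\Pi_C^{\mathbf{s}}$ (also written $\Pi_{\mathbf{a}}^{\mathbf{s}}$) is the orthogonal projector onto the common eigenspace of $T_{\mathbf{a_1}},\dots,T_{\mathbf{a_m}}$ with respective eigenvalues $\omega^{s_1},\dots,\omega^{s_m}$ (it is $0$ if this eigenspace is trivial). $M_{\mathbf{a}} = \langle\mathbf{a_1},\dots,\mathbf{a_m}\rangle$ is the $\mathbb{Z}_d$-submodule of $V$ generated by the $\mathbf{a_i}$, and $\ell_{\mathbf{s}} : M_{\mathbf{a}}\to\mathbb{Z}_d$ is the $\mathbb{Z}_d$-linear form $\ell_{\mathbf{s}}(\sum_i x_i\mathbf{a_i}) = \sum_i x_i s_i$, well defined when $\sum_i x_i s_i = 0$ for every relation $\sum_i x_i\mathbf{a_i}=0$, $x_i \in \mathbb{Z}_d$. Hidden variable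 model (HVM) for $\rho$: a triple $(S,q_\rho,p)$ where $S$ is a set, $q_\rho$ is a probability distribution over $S$, and $p = (p_C)_{C\in\mathcal{C}}$ is a family of conditional probability distributions $p_C(\mathbf{s}|\nu)$ over outcomes $\mathbf{s}\in\mathbb{Z}_d^{|C|}$, for $C \in \mathcal{C}$ and $\nu\in S$, such that $\operatorname{Tr}(\Pi_C^{\mathbf{s}}\rho) = \sum_{\nu\in S}p_C(\mathbf{s}|\nu)\,q_\rho(\nu)$ for all $C\in\mathcal{C}$ and $\mathbf{s}\in\mathbb{Z}_d^{|C|}$. It is deterministic if for every $\nu\in S$ there is a map $\alpha_\nu$ with $\alpha_\nu(C)\in\mathbb{Z}_d^{|C|}$ for each $C\in\mathcal{C}$ and $p_C(\mathbf{s}|\nu) = \delta_{\alpha_\nu(C),\mathbf{s}}$ for all $C$ and $\mathbf{s}$. Implementations: a measurement is a family of projectors $(\Pi^{s})_{s\in O}$ summing to the identity, indexed by a finite set $O$. An implementation of it is a pair $(C,\sigma_C)$ with $C = \{T_{\mathbf{a_1}},\dots,T_{\mathbf{a_m}}\}\in\mathcal{C}$ and $\sigma_C:\mathbb{Z}_d^m\to O$ surjective such that $\Pi^{s} = \sum_{\mathbf{t}\in\mathbb{Z}_d^m,\ \sigma_C(\mathbf{t})=s}\Pi_{\mathbf{a}}^{\mathbf{t}}$ for all $s\in O$. Write $p_C(\sigma_C^{-1}(s)|\nu) = \sum_{\mathbf{t}:\,\sigma_C(\mathbf{t})=s}p_C(\mathbf{t}|\nu)$. An HVM is non-contextual if for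 every $\nu\in S$ and every implementation $(C,\sigma_C)$ of a measurement $(\Pi^{s})_{s\in O}$, the probability $p_C(\sigma_C^{-1}(s)|\nu)$ depends only on the projector $\Pi^{s}$ and not on the implementation $(C,\sigma_C)$. *)

theory Defs
  imports
    "HOL-Analysis.Infinite_Sum"
    "HOL-Library.Nonpos_Ints"
    "HOL-Library.Product_Plus"
    "Jordan_Normal_Form.Schur_Decomposition"
    "Berlekamp_Zassenhaus.Finite_Field"
begin

text \<open>Throughout, \<open>d\<close> is \<open>CARD('d)\<close> for a finite type \<open>'d\<close>, the ring of integers modulo \<open>d\<close> is
  \<open>'d mod_ring\<close> and its \<open>m\<close>-th power is \<open>carrier_vec m\<close>. For \<open>d = 1\<close> there is no instance of
  \<open>comm_ring_1\<close>, so nothing below refers to the unit of \<open>'d mod_ring\<close>.\<close>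

section \<open>Linear algebra\<close>

definition mat_trace :: "complex mat \<Rightarrow> complex" where
  "mat_trace A = (\<Sum>i<dim_row A. A $$ (i, i))"

definition mat_sum :: "nat \<Rightarrow> 'a set \<Rightarrow> ('a \<Rightarrow> complex mat) \<Rightarrow> complex mat" where
  "mat_sum N A f = mat N N (\<lambda>ij. \<Sum>x\<in>A. f x $$ ij)"

definition kronecker :: "complex mat \<Rightarrow> complex mat \<Rightarrow> complex mat" where
  "kronecker A B = mat (dim_row A * dim_row B) (dim_col A * dim_col B)
     (\<lambda>(i, j). A $$ (i div dim_row B, j div dim_col B) * B $$ (i mod dim_row B, j mod dim_col B))"

definition kronecker_list :: "complex mat list \<Rightarrow> complex mat" where
  "kronecker_list As = foldr kronecker As (1\<^sub>m 1)"

definition density_matrix :: "nat \<Rightarrow> complex mat \<Rightarrow> bool" where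
  "density_matrix N \<rho> \<longleftrightarrow> \<rho> \<in> carrier_mat N N \<and> mat_adjoint \<rho> = \<rho> \<and>
     (\<forall>v\<in>carrier_vec N. (\<rho> *\<^sub>v v) \<bullet>c v \<in> \<real>\<^sub>\<ge>\<^sub>0) \<and> mat_trace \<rho> = 1"

definition orth_projector :: "nat \<Rightarrow> complex mat \<Rightarrow> bool" where
  "orth_projector N P \<longleftrightarrow> P \<in> carrier_mat N N \<and> P * P = P \<and> mat_adjoint P = P"

definition projector_onto :: "nat \<Rightarrow> complex vec set \<Rightarrow> complex mat" where
  "projector_onto N E = (THE P. orth_projector N P \<and> (\<lambda>v. P *\<^sub>v v) ` carrier_vec N = E)"

section \<open>Phase space and Heisenberg-Weyl operators\<close>

type_synonym 'd phase_vec = "'d mod_ring vec \<times> 'd mod_ring vec"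

definition phase_space :: "nat \<Rightarrow> 'd::finite phase_vec set" where
  "phase_space n = carrier_vec n \<times> carrier_vec n"

definition symp :: "'d::finite phase_vec \<Rightarrow> 'd phase_vec \<Rightarrow> 'd mod_ring" where
  "symp u v = fst u \<bullet> snd v - snd u \<bullet> fst v"

text \<open>Division by 2 in \<open>\<int>/d\<close>, meaningful for odd \<open>d\<close>.\<close>

definition half :: "'d::finite mod_ring \<Rightarrow> 'd mod_ring" where
  "half x = (THE y. y + y = x)"

definition omega :: "'d::finite itself \<Rightarrow> complex" where
  "omega _ = exp (2 * \<i> * of_real pi / of_nat CARD('d))"

definition omega_pow :: "'d::finite mod_ring \<Rightarrow> complex" where
  "omega_pow s = omega TYPE('d) powi to_int_mod_ring s"

definition pauli_X :: "'d::finite itself \<Rightarrow> complex mat" where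
  "pauli_X _ = mat CARD('d) CARD('d) (\<lambda>(i, j). if i = (j + 1) mod CARD('d) then 1 else 0)"

definition pauli_Z :: "'d::finite itself \<Rightarrow> complex mat" where
  "pauli_Z _ = mat CARD('d) CARD('d) (\<lambda>(i, j). if i = j then omega TYPE('d) ^ j else 0)"

definition tensor_pow :: "complex mat \<Rightarrow> 'd::finite mod_ring vec \<Rightarrow> complex mat" where
  "tensor_pow A a = kronecker_list (map (\<lambda>k. A ^\<^sub>m nat (to_int_mod_ring k)) (list_of_vec a))"

definition hw :: "'d::finite phase_vec \<Rightarrow> complex mat" where
  "hw u = omega_pow (- half (fst u \<bullet> snd u)) \<cdot>\<^sub>m
     (tensor_pow (pauli_Z TYPE('d)) (fst u) * tensor_pow (pauli_X TYPE('d)) (snd u))"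

section \<open>Noncontextual value assignments\<close>

definition prob_dist :: "'a set \<Rightarrow> ('a \<Rightarrow> real) \<Rightarrow> bool" where
  "prob_dist A f \<longleftrightarrow> (\<forall>x\<in>A. 0 \<le> f x) \<and> (f has_sum 1) A"

definition nc_value_assignments ::
  "nat \<Rightarrow> complex mat \<Rightarrow> 's set \<Rightarrow> ('s \<Rightarrow> real) \<Rightarrow> ('s \<Rightarrow> 'd::finite phase_vec \<Rightarrow> complex) \<Rightarrow> bool" where
  "nc_value_assignments n \<rho> S q lam \<longleftrightarrow>
     finite S \<and> prob_dist S q \<and>
     (\<forall>\<nu>\<in>S. \<forall>u\<in>phase_space n. lam \<nu> u \<in> range (omega_pow :: 'd mod_ring \<Rightarrow> complex)) \<and>
     (\<forall>\<nu>\<in>S. \<forall>u\<in>phase_space n. \<forall>v\<in>phase_space n.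
        symp u v = 0 \<longrightarrow> lam \<nu> (u + v) = lam \<nu> u * lam \<nu> v) \<and>
     (\<forall>u\<in>phase_space n. mat_trace (hw u * \<rho>) = (\<Sum>\<nu>\<in>S. lam \<nu> u * of_real (q \<nu>)))"

section \<open>Contexts\<close>

definition contexts :: "'d::finite itself \<Rightarrow> nat \<Rightarrow> complex mat list set" where
  "contexts _ n = {C. set C \<subseteq> hw ` (phase_space n :: 'd phase_vec set) \<and>
     (\<forall>A\<in>set C. \<forall>B\<in>set C. A * B = B * A)}"

text \<open>The vectors \<open>a\<^sub>1, \<dots>, a\<^sub>m\<close> of a context; they are determined by its operators since
  \<^const>\<open>hw\<close> is injective on the phase space.\<close>

definition labels :: "nat \<Rightarrow> complex mat list \<Rightarrow> 'd::finite phase_vec list" where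
  "labels n C = map (inv_into (phase_space n) hw) C"

definition context_projector :: "nat \<Rightarrow> complex mat list \<Rightarrow> 'd::finite mod_ring vec \<Rightarrow> complex mat" where
  "context_projector n C s = projector_onto (CARD('d) ^ n)
     {v \<in> carrier_vec (CARD('d) ^ n). \<forall>i<length C. C ! i *\<^sub>v v = omega_pow (s $ i) \<cdot>\<^sub>v v}"

definition lin_comb :: "nat \<Rightarrow> 'd::finite phase_vec list \<Rightarrow> 'd mod_ring vec \<Rightarrow> 'd phase_vec" where
  "lin_comb n a x = (vec n (\<lambda>j. \<Sum>i<length a. x $ i * fst (a ! i) $ j),
                     vec n (\<lambda>j. \<Sum>i<length a. x $ i * snd (a ! i) $ j))"

definition gen_module :: "nat \<Rightarrow> 'd::finite phase_vec list \<Rightarrow> 'd phase_vec set" where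
  "gen_module n a = lin_comb n a ` carrier_vec (length a)"

definition form_well_defined :: "nat \<Rightarrow> 'd::finite phase_vec list \<Rightarrow> 'd mod_ring vec \<Rightarrow> bool" where
  "form_well_defined n a s \<longleftrightarrow>
     (\<forall>x\<in>carrier_vec (length a). lin_comb n a x = (0\<^sub>v n, 0\<^sub>v n) \<longrightarrow> x \<bullet> s = 0)"

definition lin_form :: "nat \<Rightarrow> 'd::finite phase_vec list \<Rightarrow> 'd mod_ring vec \<Rightarrow> 'd phase_vec \<Rightarrow> 'd mod_ring" where
  "lin_form n a s u = (THE y. \<exists>x\<in>carrier_vec (length a). u = lin_comb n a x \<and> y = x \<bullet> s)"

section \<open>Hidden variable models\<close>

text \<open>A family \<open>p\<close> is written \<open>p C s \<nu>\<close> for \<open>p\<^sub>C(s|\<nu>)\<close>. Its values are complex numbers because the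
  families of interest are given by character sums; that they are probabilities, in particular
  real, is required by the definition of a model.\<close>

type_synonym ('d, 's) cond_family = "complex mat list \<Rightarrow> 'd mod_ring vec \<Rightarrow> 's \<Rightarrow> complex"

definition hvm ::
  "nat \<Rightarrow> complex mat \<Rightarrow> 's set \<Rightarrow> ('s \<Rightarrow> real) \<Rightarrow> ('d::finite, 's) cond_family \<Rightarrow> bool" where
  "hvm n \<rho> S q p \<longleftrightarrow>
     prob_dist S q \<and>
     (\<forall>C\<in>contexts TYPE('d) n. \<forall>\<nu>\<in>S.
        (\<forall>s\<in>carrier_vec (length C). p C s \<nu> \<in> \<real>) \<and>
        prob_dist (carrier_vec (length C)) (\<lambda>s. Re (p C s \<nu>))) \<and>
     (\<forall>C\<in>contexts TYPE('d) n. \<forall>s\<in>carrier_vec (length C).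
        ((\<lambda>\<nu>. p C s \<nu> * of_real (q \<nu>)) has_sum mat_trace (context_projector n C s * \<rho>)) S)"

definition deterministic :: "nat \<Rightarrow> 's set \<Rightarrow> ('d::finite, 's) cond_family \<Rightarrow> bool" where
  "deterministic n S p \<longleftrightarrow>
     (\<forall>\<nu>\<in>S. \<exists>\<alpha>. \<forall>C\<in>contexts TYPE('d) n. \<alpha> C \<in> carrier_vec (length C) \<and>
        (\<forall>s\<in>carrier_vec (length C). p C s \<nu> = (if \<alpha> C = s then 1 else 0)))"

definition measurement :: "nat \<Rightarrow> 'o set \<Rightarrow> ('o \<Rightarrow> complex mat) \<Rightarrow> bool" where
  "measurement N Out P \<longleftrightarrow>
     finite Out \<and> (\<forall>r\<in>Out. orth_projector N (P r)) \<and> mat_sum N Out P = 1\<^sub>m N"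

definition fiber :: "nat \<Rightarrow> ('d::finite mod_ring vec \<Rightarrow> 'o) \<Rightarrow> 'o \<Rightarrow> 'd mod_ring vec set" where
  "fiber m \<sigma> r = {t \<in> carrier_vec m. \<sigma> t = r}"

definition implementation ::
  "nat \<Rightarrow> 'o set \<Rightarrow> ('o \<Rightarrow> complex mat) \<Rightarrow> complex mat list \<Rightarrow> ('d::finite mod_ring vec \<Rightarrow> 'o) \<Rightarrow> bool" where
  "implementation n Out P C \<sigma> \<longleftrightarrow>
     C \<in> contexts TYPE('d) n \<and> \<sigma> ` carrier_vec (length C) = Out \<and>
     (\<forall>r\<in>Out. P r = mat_sum (CARD('d) ^ n) (fiber (length C) \<sigma> r) (context_projector n C))"

text \<open>The probability assigned to a projector agrees across all implementations of all measurements
  (with outcome labels in \<open>'o\<close>) in which this projector occurs.\<close>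

definition non_contextual ::
  "'o itself \<Rightarrow> nat \<Rightarrow> 's set \<Rightarrow> ('d::finite, 's) cond_family \<Rightarrow> bool" where
  "non_contextual _ n S p \<longleftrightarrow>
     (\<forall>\<nu>\<in>S. \<forall>(Out :: 'o set) P C \<sigma> r (Out' :: 'o set) P' C' \<sigma>' r'.
        measurement (CARD('d) ^ n) Out P \<and> implementation n Out P C \<sigma> \<and> r \<in> Out \<and>
        measurement (CARD('d) ^ n) Out' P' \<and> implementation n Out' P' C' \<sigma>' \<and> r' \<in> Out' \<and>
        P r = P' r' \<longrightarrow>
        (\<Sum>t\<in>fiber (length C) \<sigma> r. p C t \<nu>) = (\<Sum>t\<in>fiber (length C') \<sigma>' r'. p C' t \<nu>))"

definition assignment_family ::
  "nat \<Rightarrow> ('s \<Rightarrow> 'd::finite phase_vec \<Rightarrow> complex) \<Rightarrow> ('d, 's) cond_family" where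
  "assignment_family n lam C s \<nu> =
     (let a = labels n C in
      if form_well_defined n a s
      then (\<Sum>u\<in>gen_module n a. omega_pow (- lin_form n a s u) * lam \<nu> u) / of_nat (card (gen_module n a))
      else 0)"

end

theory Submission
  imports Defs
begin

text \<open>Commuting Heisenberg-Weyl operators satisfy \<open>T\<^sub>u T\<^sub>v = T\<^sub>u\<^sub>+\<^sub>v\<close>, so the projector of a context is the
  character average of \<open>\<omega>\<close> to the power \<open>- \<ell>\<^sub>s(u)\<close> times \<open>T\<^sub>u\<close> over the isotropic module, or 0 if
  \<open>\<ell>\<^sub>s\<close> is not well defined. The same average of \<open>\<lambda>\<^sub>\<nu>\<close> is, by orthogonality of characters, the
  indicator of \<open>\<lambda>\<^sub>\<nu>(a\<^sub>i)\<close> being \<open>\<omega>\<close> to the power \<open>s\<^sub>i\<close> for all \<open>i\<close>, which gives determinism. The operators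
  \<open>T\<^sub>u\<close> are orthogonal for the trace form, so \<open>T\<^sub>u \<mapsto> \<lambda>\<^sub>\<nu>(u)\<close> extends to a linear functional on matrices;
  its value on a context projector is the conditional probability, hence the probability of a sum of
  context projectors depends on the sum only.\<close>

section \<open>Arithmetic modulo d and the character\<close>

text \<open>The integers modulo \<open>d\<close> need not form a field: the labels of a context may
  satisfy relations without having a basis, a vector of the module may have several coefficient
  vectors, and an outcome may contradict a relation. So nothing rests on bases or dimensions;
  everything is a sum over the finite group generated by the labels. The division by 2 in the phase
  of \<open>hw\<close> makes the cocycle of the operators equal to \<open>half (symp u v)\<close>,
  which is zero exactly on commuting pairs; with another normalisation a context would be
  multiplicative only up to phases. The values \<open>lam \<nu>\<close> are multiplicative on
  commuting pairs only, so they form a character on each module of a context but not on the whole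
  phase space, and their extension to matrices is not an algebra homomorphism. Non-contextuality
  asks for a linear extension only, which exists because the operators are linearly independent. For
  \<open>d = 1\<close> the element \<open>of_int_mod_ring 1\<close> that serves as the unit is
  0.\<close>

lemma mod_ring_unit_induct [case_names 0 add]:
  fixes x :: "'d::finite mod_ring"
  assumes 0: "P 0" and add: "\<And>x. P x \<Longrightarrow> P (x + of_int_mod_ring 1)"
  shows "P x"
proof -
  have "P (of_int_mod_ring (int k) :: 'd mod_ring)" for k
  proof (induction k)
    case 0
    then show ?case using assms(1) by simp
  next
    case (Suc k)
    have "(of_int_mod_ring (int (Suc k)) :: 'd mod_ring) = of_int_mod_ring (int k) + of_int_mod_ring 1"
      by transfer (simp add: mod_simps algebra_simps)
    then show ?case using add[OF Suc] by simp
  qed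
  moreover have "x = of_int_mod_ring (int (nat (to_int_mod_ring x)))"
    by transfer auto
  ultimately show ?thesis by metis
qed

lemma mod_ring_unit_mult [simp]: "of_int_mod_ring 1 * x = (x :: 'd::finite mod_ring)"
  by transfer (simp add: mod_simps)

lemma mult_mod_ring_unit [simp]: "x * of_int_mod_ring 1 = (x :: 'd::finite mod_ring)"
  by transfer (simp add: mod_simps)

lemma of_int_mod_ring_add:
  "of_int_mod_ring (i + j) = (of_int_mod_ring i + of_int_mod_ring j :: 'd::finite mod_ring)"
  by transfer (simp add: mod_simps)

text \<open>Oddness enters through this cancellation of 2: it gives the uniqueness of halves, and it
  turns antisymmetry together with symmetry of \<open>symp\<close> into vanishing.\<close>

lemma double_eq_0_mod_ring:
  fixes y :: "'d::finite mod_ring"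
  assumes "odd CARD('d)" "y + y = 0"
  shows "y = 0"
  using assms
proof transfer
  fix y :: int
  assume *: "odd CARD('d)" "y \<in> {0..<int CARD('d)}" "(y + y) mod int CARD('d) = 0"
  then have "int CARD('d) dvd 2 * y" by (simp add: mod_eq_0_iff_dvd)
  moreover have "coprime (int CARD('d)) 2" using *(1) by simp
  ultimately have "int CARD('d) dvd y" by (simp add: coprime_dvd_mult_right_iff)
  then show "y = 0" using *(2) by (metis atLeastLessThan_iff order_le_less zdvd_not_zless)
qed

lemma half_add_half:
  fixes x :: "'d::finite mod_ring"
  assumes odd: "odd CARD('d)"
  shows "half x + half x = x" and half_unique: "y + y = x \<Longrightarrow> half x = y"
proof -
  have eq: "y = z" if "y + y = z + z" for y z :: "'d mod_ring"
  proof -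
    have "(y - z) + (y - z) = 0" using that by (simp add: algebra_simps)
    then have "y - z = 0" by (rule double_eq_0_mod_ring[OF odd])
    then show ?thesis by simp
  qed
  \<comment> \<open>An injective map of a finite ring to itself is onto, so halves exist without an
    explicit inverse of 2.\<close>
  then have "inj (\<lambda>y :: 'd mod_ring. y + y)" by (intro injI)
  then have "surj (\<lambda>y :: 'd mod_ring. y + y)" by (simp add: finite_UNIV_inj_surj)
  then obtain y where y: "y + y = x" by (metis surjD)
  have "\<exists>!y. y + y = x" using y eq by metis
  then have "half x + half x = x" unfolding half_def by (rule theI')
  then show "half x + half x = x" "y + y = x \<Longrightarrow> half x = y" for y
    using eq by metis+
qed

lemma half_0: "odd CARD('d::finite) \<Longrightarrow> half (0 :: 'd mod_ring) = 0"
  by (rule half_unique) auto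

lemma half_add:
  "odd CARD('d::finite) \<Longrightarrow> half (x + y :: 'd mod_ring) = half x + half y"
  using half_add_half(1)[of x] half_add_half(1)[of y]
  by (intro half_unique) (auto simp: algebra_simps)

lemma half_uminus: "odd CARD('d::finite) \<Longrightarrow> half (- x :: 'd mod_ring) = - half x"
  using half_add_half(1)[of x] by (intro half_unique) (metis minus_add_distrib)+

lemma half_diff: "odd CARD('d::finite) \<Longrightarrow> half (x - y :: 'd mod_ring) = half x - half y"
  using half_add[of x "- y"] by (simp add: half_uminus)

section \<open>The additive character given by powers of omega\<close>

lemma omega_powi: "omega TYPE('d::finite) powi k = exp (2 * \<i> * of_real pi * of_int k / of_nat CARD('d))"
  by (simp add: omega_def exp_power_int mult_ac)

text \<open>\<open>omega_pow\<close> uses the representative in \<open>0..<d\<close>. As omega has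
  \<open>d\<close>-th power 1, any other integer representative does as well, and additivity follows
  without treating overflow.\<close>

lemma omega_powi_eq_omega_pow: "omega TYPE('d::finite) powi k = omega_pow (of_int_mod_ring k :: 'd mod_ring)"
proof -
  have "omega TYPE('d) powi int CARD('d) = 1"
    unfolding omega_powi using exp_two_pi_i' by (simp add: mult_ac)
  then have d: "omega TYPE('d) powi (int CARD('d) * (k div int CARD('d))) = 1"
    by (simp add: power_int_mult)
  have nz: "omega TYPE('d) \<noteq> 0" by (simp add: omega_def)
  have "omega TYPE('d) powi k = omega TYPE('d) powi (int CARD('d) * (k div int CARD('d)) + k mod int CARD('d))"
    by simp
  also have "\<dots> = omega TYPE('d) powi (k mod int CARD('d))"
    by (subst power_int_add) (use d nz in simp_all)
  finally show ?thesis
    by (simp add: omega_pow_def of_int_mod_ring.rep_eq to_int_mod_ring.rep_eq)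
qed

lemma omega_pow_0 [simp]: "omega_pow 0 = 1"
  by (simp add: omega_pow_def)

lemma omega_pow_add: "omega_pow (x + y) = omega_pow x * omega_pow (y :: 'd::finite mod_ring)"
proof -
  have "omega TYPE('d) \<noteq> 0" by (simp add: omega_def)
  then have "omega_pow x * omega_pow y = omega TYPE('d) powi (to_int_mod_ring x + to_int_mod_ring y)"
    by (simp add: omega_pow_def power_int_add)
  then show ?thesis by (simp add: omega_powi_eq_omega_pow of_int_mod_ring_add)
qed

lemma omega_pow_nonzero [simp]: "omega_pow x \<noteq> 0"
  by (simp add: omega_pow_def omega_def)

lemma omega_pow_uminus: "omega_pow (- x) = inverse (omega_pow (x :: 'd::finite mod_ring))"
  using omega_pow_add[of "- x" x] by (simp add: field_simps)

lemma omega_pow_diff: "omega_pow (x - y) = omega_pow x * omega_pow (- y :: 'd::finite mod_ring)"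
  using omega_pow_add[of x "- y"] by simp

lemma cnj_omega_pow: "cnj (omega_pow x) = omega_pow (- x :: 'd::finite mod_ring)"
proof -
  have "norm (omega_pow x) = 1"
    by (simp add: omega_pow_def omega_powi)
  then have "omega_pow x * cnj (omega_pow x) = 1"
    by (simp add: complex_norm_square[symmetric])
  then have "cnj (omega_pow x) = inverse (omega_pow x)"
    by (simp add: field_simps)
  then show ?thesis by (simp add: omega_pow_uminus)
qed

text \<open>Faithfulness of the character. The real part is enough, since cosine equals 1 only at
  multiples of \<open>2 * pi\<close>; a representative below \<open>d\<close> must then be
  0.\<close>

lemma omega_pow_eq_1_iff [simp]: "omega_pow x = 1 \<longleftrightarrow> x = (0 :: 'd::finite mod_ring)"
proof
  assume 1: "omega_pow x = 1"
  define k where "k = nat (to_int_mod_ring x)"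
  have k: "to_int_mod_ring x = int k" "k < CARD('d)"
    using rangeI[of to_int_mod_ring x] unfolding range_to_int_mod_ring k_def by auto
  have "exp (\<i> * of_real (2 * pi * real k / real CARD('d))) = 1"
    using 1 k(1) omega_powi[of "int k", where 'd = 'd]
    by (simp add: omega_pow_def mult_ac del: power_int_of_nat)
  then have "Re (cis (2 * pi * real k / real CARD('d))) = Re 1"
    unfolding cis_conv_exp by (rule arg_cong)
  then have "cos (2 * pi * real k / real CARD('d)) = 1" by simp
  then obtain m :: int where "2 * pi * real k / real CARD('d) = of_int m * 2 * pi"
    using cos_one_2pi_int by blast
  then have m: "real k = of_int m * real CARD('d)"
    by (simp add: field_simps)
  then have "int k = m * int CARD('d)"
    by (metis of_int_eq_iff of_int_mult of_int_of_nat_eq)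
  then have "int CARD('d) dvd int k" by simp
  then show "x = 0" using k
    by (metis linorder_not_less nat_dvd_not_less not_gr_zero of_nat_0 of_nat_dvd_iff
        to_int_mod_ring_hom.eq_iff to_int_mod_ring_hom.hom_zero)
qed simp

lemma omega_pow_inject [simp]: "omega_pow x = omega_pow y \<longleftrightarrow> x = (y :: 'd::finite mod_ring)"
proof
  assume "omega_pow x = omega_pow y"
  then have "omega_pow (x - y) = 1"
    using omega_pow_add[of x "- y"] by (simp add: omega_pow_uminus)
  then show "x = y" by simp
qed simp

text \<open>Translating by the unit multiplies the sum by \<open>omega_pow a\<close>, which differs
  from 1 for every nonzero \<open>a\<close>, invertible or not.\<close>

lemma sum_omega_pow_mult:
  "(\<Sum>x\<in>UNIV. omega_pow (a * x :: 'd::finite mod_ring)) = (if a = 0 then of_nat CARD('d) else 0)"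
proof (cases "a = 0")
  case False
  let ?S = "\<Sum>x\<in>UNIV. omega_pow (a * x)"
  have "?S = (\<Sum>x\<in>UNIV. omega_pow (a * (x + of_int_mod_ring 1)))"
    by (rule sum.reindex_bij_witness[of _ "\<lambda>x. x + of_int_mod_ring 1" "\<lambda>x. x - of_int_mod_ring 1"]) auto
  also have "\<dots> = omega_pow a * ?S"
    by (simp add: distrib_left omega_pow_add sum_distrib_left mult.commute)
  finally have "(omega_pow a - 1) * ?S = 0" by (simp add: algebra_simps)
  then show ?thesis using False by simp
qed simp

section \<open>Kronecker products\<close>

text \<open>An index of a Kronecker product is a pair of digits in base \<open>m\<close>; splitting
  it makes matrix products and traces factor.\<close>

lemma sum_div_mod:
  fixes f :: "nat \<Rightarrow> nat \<Rightarrow> 'a::comm_monoid_add"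
  assumes "0 < m"
  shows "(\<Sum>k<n * m. f (k div m) (k mod m)) = (\<Sum>i<n. \<Sum>j<m. f i j)"
  unfolding sum.cartesian_product
proof (rule sum.reindex_bij_witness[of _ "\<lambda>(i, j). i * m + j" "\<lambda>k. (k div m, k mod m)"], goal_cases)
  case (2 k)
  then show ?case using assms by (auto simp: less_mult_imp_div_less)
next
  case (4 b)
  then obtain i j where b: "b = (i, j)" "i < n" "j < m" by auto
  have "i * m + j < Suc i * m" using b by simp
  also have "\<dots> \<le> n * m" using b by (intro mult_right_mono) auto
  finally show ?case using b by simp
qed auto

lemma dim_kronecker [simp]:
  "dim_row (kronecker A B) = dim_row A * dim_row B" "dim_col (kronecker A B) = dim_col A * dim_col B"
  by (auto simp: kronecker_def)

lemma kronecker_carrier [simp]: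
  "A \<in> carrier_mat a b \<Longrightarrow> B \<in> carrier_mat c e \<Longrightarrow> kronecker A B \<in> carrier_mat (a * c) (b * e)"
  by (auto simp: kronecker_def)

lemma kronecker_index:
  "i < dim_row A * dim_row B \<Longrightarrow> j < dim_col A * dim_col B \<Longrightarrow>
    kronecker A B $$ (i, j) = A $$ (i div dim_row B, j div dim_col B) * B $$ (i mod dim_row B, j mod dim_col B)"
  by (auto simp: kronecker_def)

lemma div_mod_less:
  fixes i :: nat
  assumes "i < a * c"
  shows "i div c < a" "i mod c < c"
  using assms by (auto simp: less_mult_imp_div_less intro!: mod_less_divisor Nat.gr0I)

lemma mult_mat_index:
  "A \<in> carrier_mat a b \<Longrightarrow> B \<in> carrier_mat b c \<Longrightarrow> i < a \<Longrightarrow> j < c \<Longrightarrow>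
    (A * B) $$ (i, j) = (\<Sum>k<b. A $$ (i, k) * B $$ (k, j))"
  by (auto simp: scalar_prod_def row_def col_def atLeast0LessThan intro!: sum.cong)

lemma kronecker_mult:
  assumes A: "A \<in> carrier_mat a a" and B: "B \<in> carrier_mat b b"
    and A': "A' \<in> carrier_mat a a" and B': "B' \<in> carrier_mat b b"
  shows "kronecker A B * kronecker A' B' = kronecker (A * A') (B * B')"
proof (rule eq_matI)
  have c: "kronecker A B \<in> carrier_mat (a * b) (a * b)" "kronecker A' B' \<in> carrier_mat (a * b) (a * b)"
    and c': "kronecker (A * A') (B * B') \<in> carrier_mat (a * b) (a * b)"
    using assms by auto
  show "dim_row (kronecker A B * kronecker A' B') = dim_row (kronecker (A * A') (B * B'))"
    "dim_col (kronecker A B * kronecker A' B') = dim_col (kronecker (A * A') (B * B'))"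
    using c c' by auto
  fix i j assume "i < dim_row (kronecker (A * A') (B * B'))" "j < dim_col (kronecker (A * A') (B * B'))"
  then have ij: "i < a * b" "j < a * b" using c' by auto
  then have b: "0 < b" by (cases b) auto
  note d = div_mod_less[OF ij(1)] div_mod_less[OF ij(2)]
  have "(kronecker A B * kronecker A' B') $$ (i, j)
    = (\<Sum>k<a * b. (A $$ (i div b, k div b) * A' $$ (k div b, j div b))
        * (B $$ (i mod b, k mod b) * B' $$ (k mod b, j mod b)))"
    unfolding mult_mat_index[OF c ij]
    by (intro sum.cong refl) (use ij assms in \<open>simp add: kronecker_index\<close>)
  also have "\<dots> = (A * A') $$ (i div b, j div b) * (B * B') $$ (i mod b, j mod b)"
    by (subst sum_div_mod[OF b, of "\<lambda>r s. (A $$ (i div b, r) * A' $$ (r, j div b))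
        * (B $$ (i mod b, s) * B' $$ (s, j mod b))"])
      (simp add: mult_mat_index[OF A A'] mult_mat_index[OF B B'] d sum_product)
  finally show "(kronecker A B * kronecker A' B') $$ (i, j) = kronecker (A * A') (B * B') $$ (i, j)"
    using ij assms by (simp add: kronecker_index)
qed

lemma mat_trace_kronecker:
  assumes A: "A \<in> carrier_mat a a" and B: "B \<in> carrier_mat b b"
  shows "mat_trace (kronecker A B) = mat_trace A * mat_trace B"
proof (cases "b = 0")
  case True
  then show ?thesis using assms by (auto simp: mat_trace_def kronecker_def)
next
  case False
  have "mat_trace (kronecker A B) = (\<Sum>k<a * b. A $$ (k div b, k div b) * B $$ (k mod b, k mod b))"
    using assms by (simp add: mat_trace_def kronecker_index)
  also have "\<dots> = mat_trace A * mat_trace B"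
    using sum_div_mod[of b "\<lambda>i j. A $$ (i, i) * B $$ (j, j)" a] False A B
    by (simp add: mat_trace_def sum_product)
  finally show ?thesis .
qed

section \<open>Adjoints, and tensor products of lists of matrices\<close>

lemma dim_mat_adjoint [simp]: "dim_row (mat_adjoint A) = dim_col A" "dim_col (mat_adjoint A) = dim_row A"
  by (auto simp: mat_adjoint_def)

lemma mat_adjoint_index:
  "i < dim_col A \<Longrightarrow> j < dim_row A \<Longrightarrow> mat_adjoint A $$ (i, j) = conjugate (A $$ (j, i))"
  by (simp add: mat_adjoint_def mat_of_rows_def)

lemma mat_adjoint_carrier [simp]: "A \<in> carrier_mat n m \<Longrightarrow> mat_adjoint A \<in> carrier_mat m n"
  by auto

lemma mat_adjoint_mult:
  fixes A B :: "complex mat"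
  assumes "A \<in> carrier_mat a b" "B \<in> carrier_mat b c"
  shows "mat_adjoint (A * B) = mat_adjoint B * mat_adjoint A"
proof (rule eq_matI)
  fix i j assume "i < dim_row (mat_adjoint B * mat_adjoint A)" "j < dim_col (mat_adjoint B * mat_adjoint A)"
  then have ij: "i < c" "j < a" using assms by auto
  have "(mat_adjoint B * mat_adjoint A) $$ (i, j) = (\<Sum>k<b. mat_adjoint B $$ (i, k) * mat_adjoint A $$ (k, j))"
    by (rule mult_mat_index) (use assms ij in auto)
  also have "\<dots> = cnj (\<Sum>k<b. A $$ (j, k) * B $$ (k, i))"
    using assms ij by (auto simp: mat_adjoint_index mult.commute intro!: sum.cong)
  also have "\<dots> = cnj ((A * B) $$ (j, i))"
    by (subst mult_mat_index[OF assms]) (use ij in auto)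
  finally show "mat_adjoint (A * B) $$ (i, j) = (mat_adjoint B * mat_adjoint A) $$ (i, j)"
    using assms ij by (simp add: mat_adjoint_index[of i "A * B" j] del: index_mult_mat(1))
qed (use assms in auto)

lemma mat_adjoint_kronecker:
  fixes A B :: "complex mat"
  shows "mat_adjoint (kronecker A B) = kronecker (mat_adjoint A) (mat_adjoint B)"
  by (intro eq_matI) (auto simp: mat_adjoint_index kronecker_index div_mod_less)

lemma kronecker_smult: "kronecker (x \<cdot>\<^sub>m A) (y \<cdot>\<^sub>m B) = (x * y) \<cdot>\<^sub>m kronecker A B"
  by (intro eq_matI) (auto simp: kronecker_index div_mod_less)

lemma kronecker_one: "kronecker (1\<^sub>m a) (1\<^sub>m b) = 1\<^sub>m (a * b)"
  by (intro eq_matI) (auto simp: kronecker_index div_mod_less, metis div_mult_mod_eq)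

lemma kronecker_list_carrier:
  "(\<And>x. x \<in> set xs \<Longrightarrow> f x \<in> carrier_mat a a) \<Longrightarrow>
    kronecker_list (map f xs) \<in> carrier_mat (a ^ length xs) (a ^ length xs)"
  unfolding kronecker_list_def by (induction xs) (auto intro!: kronecker_carrier)

lemma kronecker_list_mult:
  assumes "\<And>x. x \<in> set xs \<Longrightarrow> f x \<in> carrier_mat a a" "\<And>x. x \<in> set xs \<Longrightarrow> g x \<in> carrier_mat a a"
  shows "kronecker_list (map f xs) * kronecker_list (map g xs) = kronecker_list (map (\<lambda>x. f x * g x) xs)"
  using assms
proof (induction xs)
  case (Cons x xs)
  then show ?case
    using kronecker_list_carrier[of xs f a] kronecker_list_carrier[of xs g a]
    by (simp add: kronecker_list_def kronecker_mult[where a = a and b = "a ^ length xs"])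
qed (auto simp: kronecker_list_def)

lemma mat_trace_kronecker_list:
  assumes "\<And>x. x \<in> set xs \<Longrightarrow> f x \<in> carrier_mat a a"
  shows "mat_trace (kronecker_list (map f xs)) = (\<Prod>x\<leftarrow>xs. mat_trace (f x))"
  using assms
proof (induction xs)
  case Nil
  then show ?case by (simp add: mat_trace_def kronecker_list_def)
next
  case (Cons x xs)
  then show ?case
    using kronecker_list_carrier[of xs f a]
    by (simp add: kronecker_list_def mat_trace_kronecker[where a = a and b = "a ^ length xs"])
qed

lemma mat_adjoint_one: "mat_adjoint (1\<^sub>m n) = (1\<^sub>m n :: complex mat)"
  by (rule eq_matI) (auto simp: mat_adjoint_index)

lemma mat_adjoint_kronecker_list:
  "mat_adjoint (kronecker_list (map f xs)) = kronecker_list (map (\<lambda>x. mat_adjoint (f x)) xs)"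
  by (induction xs) (auto simp: kronecker_list_def mat_adjoint_one mat_adjoint_kronecker)

lemma kronecker_list_smult:
  "kronecker_list (map (\<lambda>x. c x \<cdot>\<^sub>m f x) xs) = (\<Prod>x\<leftarrow>xs. c x) \<cdot>\<^sub>m kronecker_list (map f xs)"
  by (induction xs) (auto simp: kronecker_list_def kronecker_smult)

lemma kronecker_list_one: "kronecker_list (map (\<lambda>x. 1\<^sub>m a) xs) = 1\<^sub>m (a ^ length xs)"
  unfolding kronecker_list_def by (induction xs) (auto simp: kronecker_one)

lemma smult_one_mat: "1 \<cdot>\<^sub>m (A :: complex mat) = A"
  by (rule eq_matI) auto

lemma smult_smult_mat: "a \<cdot>\<^sub>m (b \<cdot>\<^sub>m A) = (a * b) \<cdot>\<^sub>m (A :: complex mat)"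
  by (rule eq_matI) auto

section \<open>Heisenberg-Weyl operators\<close>

text \<open>Matrix indices are naturals below \<open>d\<close> while exponents are ring elements.
  This identification allows matrix entries to be written in ring arithmetic, without explicit
  reduction modulo \<open>d\<close>.\<close>

definition residue :: "nat \<Rightarrow> 'd::finite mod_ring" where
  "residue i = of_int_mod_ring (int i)"

lemma bij_betw_residue: "bij_betw (residue :: nat \<Rightarrow> 'd::finite mod_ring) {..<CARD('d)} UNIV"
proof (rule bij_betw_byWitness[where f' = "\<lambda>x. nat (to_int_mod_ring x)"])
  have "to_int_mod_ring x \<in> {0..<int CARD('d)}" for x :: "'d mod_ring"
    using range_to_int_mod_ring by blast
  then show "range (\<lambda>x :: 'd mod_ring. nat (to_int_mod_ring x)) \<subseteq> {..<CARD('d)}"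
    "\<forall>x \<in> UNIV. residue (nat (to_int_mod_ring x)) = (x :: 'd mod_ring)"
    by (auto simp: residue_def nat_less_iff)
qed (auto simp: residue_def)

lemma residue_inject [simp]:
  "i < CARD('d) \<Longrightarrow> j < CARD('d) \<Longrightarrow> residue i = (residue j :: 'd::finite mod_ring) \<longleftrightarrow> i = j"
  using bij_betw_residue[where 'd = 'd] by (auto simp: bij_betw_def inj_on_def)

lemma residue_add: "residue (i + j) = (residue i + residue j :: 'd::finite mod_ring)"
  by (simp add: residue_def of_int_mod_ring_add)

lemma residue_mod: "residue (i mod CARD('d)) = (residue i :: 'd::finite mod_ring)"
  unfolding residue_def by transfer (simp add: of_nat_mod)

lemma residue_1: "residue (Suc 0) = (of_int_mod_ring 1 :: 'd::finite mod_ring)"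
  by (simp add: residue_def)

lemma omega_pow_residue: "omega_pow (residue k :: 'd::finite mod_ring) = omega TYPE('d) ^ k"
  by (simp add: residue_def flip: omega_powi_eq_omega_pow)

lemma sum_residue: "(\<Sum>i<CARD('d). f (residue i)) = (\<Sum>x\<in>(UNIV :: 'd::finite mod_ring set). f x)"
  by (rule sum.reindex_bij_betw[OF bij_betw_residue])

text \<open>The one-site matrix \<open>Z^a X^b\<close>, given by its entries so that the group law
  can be computed for all ring exponents at once.\<close>

definition site_op :: "'d::finite mod_ring \<Rightarrow> 'd mod_ring \<Rightarrow> complex mat" where
  "site_op a b = mat CARD('d) CARD('d)
     (\<lambda>(i, j). if residue i = (residue j + b :: 'd mod_ring) then omega_pow (a * residue i) else 0)"

lemma site_op_carrier [simp]: "site_op (a :: 'd::finite mod_ring) b \<in> carrier_mat CARD('d) CARD('d)"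
  by (simp add: site_op_def)

text \<open>The Weyl relation: moving \<open>X^b\<close> past the second clock factor, of exponent
  \<open>a'\<close>, costs the phase \<open>- (a' * b)\<close>.\<close>

lemma site_op_mult:
  "site_op (a :: 'd::finite mod_ring) b * site_op a' b' = omega_pow (- (a' * b)) \<cdot>\<^sub>m site_op (a + a') (b + b')"
proof (rule eq_matI)
  fix i k assume "i < dim_row (omega_pow (- (a' * b)) \<cdot>\<^sub>m site_op (a + a') (b + b'))"
    "k < dim_col (omega_pow (- (a' * b)) \<cdot>\<^sub>m site_op (a + a') (b + b'))"
  then have ik: "i < CARD('d)" "k < CARD('d)" by (auto simp: site_op_def)
  let ?i = "residue i :: 'd mod_ring" and ?k = "residue k :: 'd mod_ring"
  have "(site_op a b * site_op a' b') $$ (i, k)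
    = (\<Sum>j<CARD('d). (if ?i = residue j + b then omega_pow (a * ?i) else 0)
        * (if residue j = ?k + b' then omega_pow (a' * residue j) else 0))"
    by (subst mult_mat_index[OF site_op_carrier site_op_carrier ik]) (use ik in \<open>simp add: site_op_def\<close>)
  also have "\<dots> = (\<Sum>x\<in>UNIV. (if ?i = x + b then omega_pow (a * ?i) else 0)
        * (if x = ?k + b' then omega_pow (a' * x) else 0))"
    by (rule sum_residue)
  \<comment> \<open>A column of the second factor has one nonzero entry, so the sum over the middle
    index collapses.\<close>
  also have "\<dots> = (\<Sum>x\<in>UNIV. if x = ?k + b'
      then (if ?i = x + b then omega_pow (a * ?i) else 0) * omega_pow (a' * x) else 0)"
    by (intro sum.cong) auto
  also have "\<dots> = (if ?i = ?k + b' + b then omega_pow (a * ?i) else 0) * omega_pow (a' * (?k + b'))"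
    by simp
  also have "\<dots> = (omega_pow (- (a' * b)) \<cdot>\<^sub>m site_op (a + a') (b + b')) $$ (i, k)"
    using ik by (auto simp: site_op_def algebra_simps simp flip: omega_pow_add)
  finally show "(site_op a b * site_op a' b') $$ (i, k)
    = (omega_pow (- (a' * b)) \<cdot>\<^sub>m site_op (a + a') (b + b')) $$ (i, k)" .
qed (auto simp: site_op_def)

lemma site_op_0: "site_op 0 (0 :: 'd::finite mod_ring) = 1\<^sub>m CARD('d)"
  by (rule eq_matI) (auto simp: site_op_def)

text \<open>The adjoint of \<open>Z^a X^b\<close> is \<open>X^(-b) Z^(-a)\<close>; restoring the
  order produces the phase.\<close>

lemma mat_adjoint_site_op:
  "mat_adjoint (site_op (a :: 'd::finite mod_ring) b) = omega_pow (- (a * b)) \<cdot>\<^sub>m site_op (- a) (- b)"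
  by (rule eq_matI)
    (auto simp: site_op_def mat_adjoint_index cnj_omega_pow algebra_simps simp flip: omega_pow_add,
      metis distrib_left)

text \<open>A nontrivial shift has zero diagonal, and without a shift the trace is a character sum.
  Trace orthogonality of all the operators originates here.\<close>

lemma mat_trace_site_op:
  "mat_trace (site_op (a :: 'd::finite mod_ring) b) = (if a = 0 \<and> b = 0 then of_nat CARD('d) else 0)"
proof -
  have "mat_trace (site_op a b) = (\<Sum>i<CARD('d). if b = 0 then omega_pow (a * residue i) else 0)"
    by (simp add: mat_trace_def site_op_def)
  also have "\<dots> = (\<Sum>x\<in>UNIV. if b = 0 then omega_pow (a * x) else 0)"
    by (rule sum_residue)
  finally show ?thesis by (cases "b = 0") (simp_all add: sum_omega_pow_mult)
qed

lemma pauli_X_pow: "pauli_X TYPE('d::finite) ^\<^sub>m k = site_op 0 (residue k :: 'd mod_ring)"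
proof -
  have X: "pauli_X TYPE('d) = site_op 0 (residue 1 :: 'd mod_ring)"
  proof (rule eq_matI)
    fix i j assume "i < dim_row (site_op 0 (residue 1 :: 'd mod_ring))" "j < dim_col (site_op 0 (residue 1 :: 'd mod_ring))"
    then have "i < CARD('d)" "j < CARD('d)" by (auto simp: site_op_def)
    moreover have "residue j + residue 1 = (residue ((j + 1) mod CARD('d)) :: 'd mod_ring)"
      using residue_add[of j 1, where 'd = 'd] by (simp add: residue_mod)
    ultimately show "pauli_X TYPE('d) $$ (i, j) = site_op 0 (residue 1 :: 'd mod_ring) $$ (i, j)"
      by (simp add: pauli_X_def site_op_def)
  qed (auto simp: pauli_X_def site_op_def)
  show ?thesis
  proof (induction k)
    case 0
    then show ?case by (simp add: residue_def site_op_0 pauli_X_def)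
  next
    case (Suc k)
    then show ?case using residue_add[of k 1, where 'd = 'd] by (simp add: X site_op_mult smult_one_mat)
  qed
qed

lemma pauli_Z_pow: "pauli_Z TYPE('d::finite) ^\<^sub>m k = site_op (residue k :: 'd mod_ring) 0"
proof -
  have Z: "pauli_Z TYPE('d) = site_op (residue 1 :: 'd mod_ring) 0"
    by (rule eq_matI)
      (auto simp: pauli_Z_def site_op_def omega_pow_residue residue_1)
  show ?thesis
  proof (induction k)
    case 0
    then show ?case by (simp add: residue_def site_op_0 pauli_Z_def)
  next
    case (Suc k)
    then show ?case using residue_add[of k 1, where 'd = 'd] by (simp add: Z site_op_mult smult_one_mat)
  qed
qed

lemma residue_to_int: "residue (nat (to_int_mod_ring x)) = (x :: 'd::finite mod_ring)"
proof -
  have "0 \<le> to_int_mod_ring x" using rangeI[of to_int_mod_ring x] unfolding range_to_int_mod_ring by simp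
  then show ?thesis by (simp add: residue_def)
qed

section \<open>Operators on \<open>n\<close> sites: product, adjoint and trace\<close>

lemma phase_space_dim:
  "u \<in> phase_space n \<Longrightarrow> fst u \<in> carrier_vec n \<and> snd u \<in> carrier_vec n \<and> dim_vec (fst u) = n \<and> dim_vec (snd u) = n"
  by (auto simp: phase_space_def)

text \<open>The operator \<open>hw u\<close> without its scalar phase, so that computations can be
  made site by site and the phases collected afterwards.\<close>

definition displacement :: "nat \<Rightarrow> 'd::finite phase_vec \<Rightarrow> complex mat" where
  "displacement n u = kronecker_list (map (\<lambda>i. site_op (fst u $ i) (snd u $ i)) [0..<n])"

lemma displacement_carrier [simp]:
  "displacement n (u :: 'd::finite phase_vec) \<in> carrier_mat (CARD('d) ^ n) (CARD('d) ^ n)"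
  using kronecker_list_carrier[of "[0..<n]" "\<lambda>i. site_op (fst u $ i) (snd u $ i)" "CARD('d)"]
  by (simp add: displacement_def)

lemma hw_eq_displacement:
  assumes "u \<in> phase_space n"
  shows "hw u = omega_pow (- half (fst u \<bullet> snd u)) \<cdot>\<^sub>m displacement n (u :: 'd::finite phase_vec)"
proof -
  note u = phase_space_dim[OF assms]
  have X: "tensor_pow (pauli_X TYPE('d)) (snd u) = kronecker_list (map (\<lambda>i. site_op 0 (snd u $ i)) [0..<n])"
    and Z: "tensor_pow (pauli_Z TYPE('d)) (fst u) = kronecker_list (map (\<lambda>i. site_op (fst u $ i) 0) [0..<n])"
    using u by (simp_all add: tensor_pow_def list_of_vec_map pauli_X_pow pauli_Z_pow residue_to_int o_def)
  show ?thesis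
    unfolding hw_def X Z displacement_def
    by (subst kronecker_list_mult[where a = "CARD('d)"]) (auto simp: site_op_mult smult_one_mat)
qed

lemma hw_carrier [simp]:
  "u \<in> phase_space n \<Longrightarrow> hw (u :: 'd::finite phase_vec) \<in> carrier_mat (CARD('d) ^ n) (CARD('d) ^ n)"
  by (simp add: hw_eq_displacement)

lemma prod_list_omega_pow: "(\<Prod>i\<leftarrow>[0..<n]. omega_pow (f i)) = omega_pow (\<Sum>i<n. f i)"
  by (induction n) (auto simp: omega_pow_add)

lemma displacement_mult:
  assumes u: "u \<in> phase_space n" and v: "v \<in> phase_space n"
  shows "displacement n u * displacement n v
    = omega_pow (- (fst v \<bullet> snd u)) \<cdot>\<^sub>m displacement n (u + v :: 'd::finite phase_vec)"
proof -
  have "displacement n u * displacement n v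
    = kronecker_list (map (\<lambda>i. omega_pow (- (fst v $ i * snd u $ i)) \<cdot>\<^sub>m
        site_op (fst u $ i + fst v $ i) (snd u $ i + snd v $ i)) [0..<n])"
    unfolding displacement_def
    by (subst kronecker_list_mult[where a = "CARD('d)"]) (auto simp: site_op_mult)
  also have "\<dots> = omega_pow (\<Sum>i<n. - (fst v $ i * snd u $ i)) \<cdot>\<^sub>m
      kronecker_list (map (\<lambda>i. site_op (fst u $ i + fst v $ i) (snd u $ i + snd v $ i)) [0..<n])"
    by (simp add: kronecker_list_smult prod_list_omega_pow)
  also have "map (\<lambda>i. site_op (fst u $ i + fst v $ i) (snd u $ i + snd v $ i)) [0..<n]
    = map (\<lambda>i. site_op (fst (u + v) $ i) (snd (u + v) $ i)) [0..<n]"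
    using phase_space_dim[OF u] phase_space_dim[OF v] by auto
  also have "(\<Sum>i<n. - (fst v $ i * snd u $ i)) = - (fst v \<bullet> snd u)"
    using phase_space_dim[OF u] phase_space_dim[OF v]
    by (simp add: scalar_prod_def sum_negf atLeast0LessThan)
  finally show ?thesis by (simp only: displacement_def)
qed

lemma phase_space_closed [simp]:
  "u \<in> phase_space n \<Longrightarrow> v \<in> phase_space n \<Longrightarrow> u + v \<in> phase_space n"
  "u \<in> phase_space n \<Longrightarrow> - u \<in> phase_space n"
  "(0\<^sub>v n, 0\<^sub>v n) \<in> phase_space n"
  by (auto simp: phase_space_def)

text \<open>The bare product carries the one-sided cross term \<open>fst v \<bullet> snd u\<close>.
  The normalising phases turn it into its antisymmetric version, so commuting pairs acquire no phase
  at all.\<close>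

lemma hw_mult:
  assumes odd: "odd CARD('d)" and u: "u \<in> phase_space n" and v: "v \<in> phase_space n"
  shows "hw u * hw v = omega_pow (half (symp u v)) \<cdot>\<^sub>m hw (u + v :: 'd::finite phase_vec)"
proof -
  note c = phase_space_dim[OF u] phase_space_dim[OF v]
  have uv: "fst (u + v) \<bullet> snd (u + v) = fst u \<bullet> snd u + fst u \<bullet> snd v + fst v \<bullet> snd u + fst v \<bullet> snd v"
    using c by (simp add: add_scalar_prod_distrib[of _ n] scalar_prod_add_distrib[of _ n])
  have comm: "snd u \<bullet> fst v = fst v \<bullet> snd u"
    using c comm_scalar_prod by metis
  have "hw u * hw v = (omega_pow (- half (fst u \<bullet> snd u)) * omega_pow (- half (fst v \<bullet> snd v))) \<cdot>\<^sub>m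
      (displacement n u * displacement n v)"
    unfolding hw_eq_displacement[OF u] hw_eq_displacement[OF v]
    by (simp add: smult_smult_mat mult.commute
        mult_smult_assoc_mat[OF displacement_carrier smult_carrier_mat[OF displacement_carrier]]
        mult_smult_distrib[OF displacement_carrier displacement_carrier])
  also have "\<dots> = omega_pow (- half (fst u \<bullet> snd u) - half (fst v \<bullet> snd v) - fst v \<bullet> snd u) \<cdot>\<^sub>m displacement n (u + v)"
    using u v by (simp add: displacement_mult smult_smult_mat flip: omega_pow_add)
  also have "- half (fst u \<bullet> snd u) - half (fst v \<bullet> snd v) - fst v \<bullet> snd u
    = half (symp u v) - half (fst (u + v) \<bullet> snd (u + v))"
  proof -
    \<comment> \<open>The cross term is split in two: one half is the negative part of
      \<open>half (symp u v)\<close>, the other belongs to the phase at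
      \<open>u + v\<close>.\<close>
    let ?h = "half (fst v \<bullet> snd u)"
    have "- half (fst u \<bullet> snd u) - half (fst v \<bullet> snd v) - fst v \<bullet> snd u
      = - half (fst u \<bullet> snd u) - half (fst v \<bullet> snd v) - (?h + ?h)"
      by (simp only: half_add_half(1)[OF odd])
    then show ?thesis
      unfolding uv symp_def comm half_add[OF odd] half_diff[OF odd] by (simp add: algebra_simps)
  qed
  finally show ?thesis
    using u v by (simp add: hw_eq_displacement[of _ n] smult_smult_mat flip: omega_pow_add)
qed

lemma mat_adjoint_smult: "mat_adjoint (c \<cdot>\<^sub>m A) = cnj c \<cdot>\<^sub>m mat_adjoint A"
  by (rule eq_matI) (auto simp: mat_adjoint_index)

lemma mat_adjoint_hw:
  assumes odd: "odd CARD('d)" and u: "u \<in> phase_space n"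
  shows "mat_adjoint (hw u) = hw (- u :: 'd::finite phase_vec)"
proof -
  note c = phase_space_dim[OF u]
  have "mat_adjoint (displacement n u) = kronecker_list (map (\<lambda>i. omega_pow (- (fst u $ i * snd u $ i)) \<cdot>\<^sub>m
        site_op (- (fst u $ i)) (- (snd u $ i))) [0..<n])"
    by (simp add: displacement_def mat_adjoint_kronecker_list mat_adjoint_site_op)
  also have "\<dots> = omega_pow (\<Sum>i<n. - (fst u $ i * snd u $ i)) \<cdot>\<^sub>m
      kronecker_list (map (\<lambda>i. site_op (- (fst u $ i)) (- (snd u $ i))) [0..<n])"
    by (simp add: kronecker_list_smult prod_list_omega_pow)
  also have "map (\<lambda>i. site_op (- (fst u $ i)) (- (snd u $ i))) [0..<n]
    = map (\<lambda>i. site_op (fst (- u) $ i) (snd (- u) $ i)) [0..<n]"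
    using c by auto
  also have "(\<Sum>i<n. - (fst u $ i * snd u $ i)) = - (fst u \<bullet> snd u)"
    using c by (simp add: scalar_prod_def sum_negf atLeast0LessThan)
  finally have *: "mat_adjoint (displacement n u) = omega_pow (- (fst u \<bullet> snd u)) \<cdot>\<^sub>m displacement n (- u)"
    by (simp only: displacement_def)
  \<comment> \<open>Conjugation reverses the normalising phase and reordering subtracts the full
    product. What remains is the normalising phase of \<open>- u\<close>, since the product of the
    two components is even in \<open>u\<close>.\<close>
  have half: "half (fst u \<bullet> snd u) - fst u \<bullet> snd u = - half (fst u \<bullet> snd u)"
    by (metis add_diff_cancel_left' half_add_half(1)[OF odd] minus_diff_eq)
  have "fst (- u) \<bullet> snd (- u) = fst u \<bullet> snd u"
    using c by simp
  then show ?thesis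
    using u *
    by (simp add: hw_eq_displacement[of _ n] mat_adjoint_smult half cnj_omega_pow smult_smult_mat
        algebra_simps flip: omega_pow_add)
qed

lemma hw_0: "odd CARD('d) \<Longrightarrow> hw (0\<^sub>v n, 0\<^sub>v n :: 'd::finite mod_ring vec) = 1\<^sub>m (CARD('d) ^ n)"
proof -
  assume odd: "odd CARD('d)"
  have "displacement n (0\<^sub>v n, 0\<^sub>v n :: 'd mod_ring vec) = kronecker_list (map (\<lambda>i. 1\<^sub>m CARD('d)) [0..<n])"
    unfolding displacement_def by (rule arg_cong[of _ _ kronecker_list]) (auto simp: site_op_0)
  then have "displacement n (0\<^sub>v n, 0\<^sub>v n :: 'd mod_ring vec) = 1\<^sub>m (CARD('d) ^ n)"
    by (simp add: kronecker_list_one)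
  then show ?thesis using odd by (auto simp: hw_eq_displacement[of _ n] half_0)
qed

lemma mat_trace_smult: "mat_trace (c \<cdot>\<^sub>m A) = c * mat_trace A" if "A \<in> carrier_mat N N"
  using that by (auto simp: mat_trace_def sum_distrib_left)

text \<open>The trace is a phase times the product of the site traces, so one nonzero component of
  \<open>u\<close> makes it vanish.\<close>

lemma mat_trace_hw:
  assumes odd: "odd CARD('d)" and u: "u \<in> phase_space n"
  shows "mat_trace (hw (u :: 'd::finite phase_vec)) = (if u = (0\<^sub>v n, 0\<^sub>v n) then of_nat (CARD('d) ^ n) else 0)"
proof (cases "u = (0\<^sub>v n, 0\<^sub>v n)")
  case True
  then show ?thesis using hw_0[OF odd, of n] by (simp add: mat_trace_def)
next
  case False
  note c = phase_space_dim[OF u]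
  have "fst u \<noteq> 0\<^sub>v n \<or> snd u \<noteq> 0\<^sub>v n" using False by (cases u) auto
  then obtain i where i: "i < n" "fst u $ i \<noteq> 0 \<or> snd u $ i \<noteq> 0"
    using c by (metis eq_vecI index_zero_vec)
  have "mat_trace (displacement n u) = (\<Prod>i\<leftarrow>[0..<n]. mat_trace (site_op (fst u $ i) (snd u $ i)))"
    unfolding displacement_def by (rule mat_trace_kronecker_list[where a = "CARD('d)"]) auto
  also have "\<dots> = 0"
    using i by (auto simp: prod_list_zero_iff mat_trace_site_op image_iff intro!: bexI[of _ i])
  finally show ?thesis
    using False u by (simp add: hw_eq_displacement[of _ n] mat_trace_smult[OF displacement_carrier])
qed

section \<open>Sums of matrices and orthogonal projectors\<close>

lemma mat_sum_carrier [simp]: "mat_sum N A f \<in> carrier_mat N N"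
  and mat_sum_dim [simp]: "dim_row (mat_sum N A f) = N" "dim_col (mat_sum N A f) = N"
  and mat_sum_index [simp]: "i < N \<Longrightarrow> j < N \<Longrightarrow> mat_sum N A f $$ (i, j) = (\<Sum>x\<in>A. f x $$ (i, j))"
  by (auto simp: mat_sum_def)

lemma mat_sum_eqI:
  assumes "\<And>i j. i < N \<Longrightarrow> j < N \<Longrightarrow> (\<Sum>x\<in>A. f x $$ (i, j)) = (\<Sum>x\<in>B. g x $$ (i, j))"
  shows "mat_sum N A f = mat_sum N B g"
  by (rule eq_matI) (use assms in auto)

lemma mult_mat_sum:
  assumes B: "B \<in> carrier_mat N N" and f: "\<And>x. x \<in> A \<Longrightarrow> f x \<in> carrier_mat N N"
  shows "B * mat_sum N A f = mat_sum N A (\<lambda>x. B * f x)"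
proof (rule eq_matI)
  fix i j assume "i < dim_row (mat_sum N A (\<lambda>x. B * f x))" "j < dim_col (mat_sum N A (\<lambda>x. B * f x))"
  then have ij: "i < N" "j < N" by auto
  have "(B * mat_sum N A f) $$ (i, j) = (\<Sum>k<N. \<Sum>x\<in>A. B $$ (i, k) * f x $$ (k, j))"
    using ij by (subst mult_mat_index[OF B mat_sum_carrier]) (auto simp: sum_distrib_left)
  also have "\<dots> = (\<Sum>x\<in>A. (B * f x) $$ (i, j))"
    using ij by (subst sum.swap) (auto simp: mult_mat_index[OF B f] intro!: sum.cong)
  finally show "(B * mat_sum N A f) $$ (i, j) = mat_sum N A (\<lambda>x. B * f x) $$ (i, j)"
    using ij by (simp only: mat_sum_index)
qed (use assms in auto)

lemma mat_sum_mult: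
  assumes B: "B \<in> carrier_mat N N" and f: "\<And>x. x \<in> A \<Longrightarrow> f x \<in> carrier_mat N N"
  shows "mat_sum N A f * B = mat_sum N A (\<lambda>x. f x * B)"
proof (rule eq_matI)
  fix i j assume "i < dim_row (mat_sum N A (\<lambda>x. f x * B))" "j < dim_col (mat_sum N A (\<lambda>x. f x * B))"
  then have ij: "i < N" "j < N" by auto
  have "(mat_sum N A f * B) $$ (i, j) = (\<Sum>k<N. \<Sum>x\<in>A. f x $$ (i, k) * B $$ (k, j))"
    using ij by (subst mult_mat_index[OF mat_sum_carrier B]) (auto simp: sum_distrib_right)
  also have "\<dots> = (\<Sum>x\<in>A. (f x * B) $$ (i, j))"
    using ij by (subst sum.swap) (auto simp: mult_mat_index[OF f B] intro!: sum.cong)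
  finally show "(mat_sum N A f * B) $$ (i, j) = mat_sum N A (\<lambda>x. f x * B) $$ (i, j)"
    using ij by (simp only: mat_sum_index)
qed (use assms in auto)

lemma smult_mat_mult_vec:
  "A \<in> carrier_mat nr nc \<Longrightarrow> v \<in> carrier_vec nc \<Longrightarrow> (c \<cdot>\<^sub>m A) *\<^sub>v v = c \<cdot>\<^sub>v (A *\<^sub>v (v :: complex vec))"
  by (intro eq_vecI) auto

lemma mat_sum_mult_vec:
  assumes v: "v \<in> carrier_vec N" and f: "\<And>x. x \<in> A \<Longrightarrow> f x \<in> carrier_mat N N" and i: "i < N"
  shows "(mat_sum N A f *\<^sub>v v) $ i = (\<Sum>x\<in>A. (f x *\<^sub>v v) $ i)"
proof -
  have *: "(B *\<^sub>v v) $ i = (\<Sum>k<N. B $$ (i, k) * v $ k)" if "B \<in> carrier_mat N N" for B :: "complex mat"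
    using that v i by (auto simp: scalar_prod_def row_def atLeast0LessThan intro!: sum.cong)
  show ?thesis
    using i by (subst *[OF mat_sum_carrier]) (auto simp: * f sum_distrib_right sum.swap[of _ A])
qed

lemma mat_trace_mat_sum:
  assumes "\<And>x. x \<in> A \<Longrightarrow> f x \<in> carrier_mat N N"
  shows "mat_trace (mat_sum N A f) = (\<Sum>x\<in>A. mat_trace (f x))"
  using assms by (auto simp: mat_trace_def sum.swap[of _ A] intro!: sum.cong)

lemma mat_adjoint_mat_sum:
  assumes "\<And>x. x \<in> A \<Longrightarrow> f x \<in> carrier_mat N N"
  shows "mat_adjoint (mat_sum N A f) = mat_sum N A (\<lambda>x. mat_adjoint (f x))"
  using assms by (intro eq_matI) (auto simp: mat_adjoint_index carrier_matD[OF assms] intro!: sum.cong)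

section \<open>Uniqueness of the orthogonal projector onto a subspace\<close>

lemma eq_mat_if_mult_vec_eq:
  fixes A B :: "complex mat"
  assumes A: "A \<in> carrier_mat N N" and B: "B \<in> carrier_mat N N"
    and eq: "\<And>v. v \<in> carrier_vec N \<Longrightarrow> A *\<^sub>v v = B *\<^sub>v v"
  shows "A = B"
proof (rule eq_matI)
  fix i j assume ij: "i < dim_row B" "j < dim_col B"
  then have "(A *\<^sub>v unit_vec N j) $ i = (B *\<^sub>v unit_vec N j) $ i"
    using eq by simp
  then show "A $$ (i, j) = B $$ (i, j)"
    using A B ij by auto
qed (use A B in auto)

text \<open>Two orthogonal projectors with the same range absorb each other; the adjoint exchanges
  the two factors, so they are equal. The definite description is thus evaluated by exhibiting one
  projector.\<close>

lemma projector_onto_eqI: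
  assumes P: "orth_projector N P" and E: "(\<lambda>v. P *\<^sub>v v) ` carrier_vec N = E"
  shows "projector_onto N E = P"
  unfolding projector_onto_def
proof (rule the_equality)
  have absorb: "A * B = B" if A: "orth_projector N A" and B: "orth_projector N B"
    and le: "(\<lambda>v. B *\<^sub>v v) ` carrier_vec N \<subseteq> (\<lambda>v. A *\<^sub>v v) ` carrier_vec N" for A B
  proof (rule eq_mat_if_mult_vec_eq)
    note c = A[unfolded orth_projector_def] B[unfolded orth_projector_def]
    show "A * B \<in> carrier_mat N N" "B \<in> carrier_mat N N" using c by auto
    fix v :: "complex vec" assume v: "v \<in> carrier_vec N"
    obtain w where w: "w \<in> carrier_vec N" "B *\<^sub>v v = A *\<^sub>v w" using le v by blast
    have "(A * B) *\<^sub>v v = A *\<^sub>v (A *\<^sub>v w)" using c v w(2) assoc_mult_mat_vec[of A N N B N v] by simp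
    also have "\<dots> = (A * A) *\<^sub>v w" using c w(1) assoc_mult_mat_vec[of A N N A N w] by simp
    finally show "(A * B) *\<^sub>v v = B *\<^sub>v v" using c w(2) by simp
  qed
  fix Q assume "orth_projector N Q \<and> (\<lambda>v. Q *\<^sub>v v) ` carrier_vec N = E"
  then have Q: "orth_projector N Q" and QE: "(\<lambda>v. Q *\<^sub>v v) ` carrier_vec N = E" by auto
  have "Q = mat_adjoint (P * Q)"
    using absorb[OF P Q] Q by (simp add: E QE orth_projector_def)
  also have "\<dots> = Q * P"
    using P Q mat_adjoint_mult[of P N N Q N] by (simp add: orth_projector_def)
  also have "\<dots> = P"
    using absorb[OF Q P] by (simp add: E QE)
  finally show "Q = P" .
qed (use assms in blast)

section \<open>Isotropic submodules\<close>

lemma symp_self: "u \<in> phase_space n \<Longrightarrow> symp u u = 0"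
  using comm_scalar_prod[of "fst u" n "snd u"] by (auto simp: symp_def phase_space_def)

lemma symp_uminus_self:
  assumes "u \<in> phase_space n"
  shows "symp u (- u) = 0" "symp (- u) u = 0"
  using symp_self[OF assms] phase_space_dim[OF assms] by (simp_all add: symp_def)

lemma symp_commute: "u \<in> phase_space n \<Longrightarrow> v \<in> phase_space n \<Longrightarrow> symp u v = - symp v u"
  using comm_scalar_prod[of "fst u" n "snd v"] comm_scalar_prod[of "snd u" n "fst v"]
  by (auto simp: symp_def phase_space_def)

lemma symp_add_left:
  "u \<in> phase_space n \<Longrightarrow> v \<in> phase_space n \<Longrightarrow> w \<in> phase_space n \<Longrightarrow> symp (u + v) w = symp u w + symp v w"
  by (auto simp: symp_def phase_space_def add_scalar_prod_distrib[of _ n] algebra_simps)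

definition scale_phase :: "'d::finite mod_ring \<Rightarrow> 'd phase_vec \<Rightarrow> 'd phase_vec" where
  "scale_phase c u = (c \<cdot>\<^sub>v fst u, c \<cdot>\<^sub>v snd u)"

lemma scale_phase_closed [simp]: "u \<in> phase_space n \<Longrightarrow> scale_phase c u \<in> phase_space n"
  by (auto simp: scale_phase_def phase_space_def)

lemma symp_scale_left:
  "u \<in> phase_space n \<Longrightarrow> v \<in> phase_space n \<Longrightarrow> symp (scale_phase c u) v = c * symp u v"
  by (auto simp: symp_def phase_space_def scale_phase_def smult_scalar_prod_distrib[of _ n] algebra_simps)

lemma phase_cancel: "v \<in> phase_space n \<Longrightarrow> u \<in> phase_space n \<Longrightarrow> - v + (v + u) = u"
  "v \<in> phase_space n \<Longrightarrow> u \<in> phase_space n \<Longrightarrow> v + (- v + u) = u"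
  "u \<in> phase_space n \<Longrightarrow> - (- u) = u"
  by (auto simp: phase_space_def prod_eq_iff)

lemma phase_diff_eq_0:
  "v \<in> phase_space n \<Longrightarrow> u \<in> phase_space n \<Longrightarrow> - v + u = (0\<^sub>v n, 0\<^sub>v n) \<longleftrightarrow> u = v"
proof
  assume v: "v \<in> phase_space n" and u: "u \<in> phase_space n" and "- v + u = (0\<^sub>v n, 0\<^sub>v n)"
  then have "u = v + (0\<^sub>v n, 0\<^sub>v n)" using phase_cancel(2)[OF v u] by simp
  then show "u = v" using v by (auto simp: phase_space_def)
qed (auto simp: phase_space_def)

lemma finite_carrier_vec_mod_ring [simp]: "finite (carrier_vec n :: 'd::finite mod_ring vec set)"
proof (rule finite_surj)
  show "finite {xs :: 'd mod_ring list. set xs \<subseteq> UNIV \<and> length xs = n}"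
    by (rule finite_lists_length_eq) simp
  show "(carrier_vec n :: 'd mod_ring vec set) \<subseteq> vec_of_list ` {xs. set xs \<subseteq> UNIV \<and> length xs = n}"
    by (auto simp: image_iff) (metis carrier_vecD length_list_of_vec vec_list)
qed

lemma finite_phase_space [simp]: "finite (phase_space n :: 'd::finite phase_vec set)"
  by (simp add: phase_space_def)

text \<open>The sum \<open>lin_comb\<close> cut off after \<open>k\<close> labels: an induction on
  \<open>k\<close> can then keep \<open>a\<close> and \<open>x\<close> fixed.\<close>

definition partial_comb :: "nat \<Rightarrow> nat \<Rightarrow> 'd::finite phase_vec list \<Rightarrow> 'd mod_ring vec \<Rightarrow> 'd phase_vec" where
  "partial_comb n k a x = (vec n (\<lambda>j. \<Sum>i<k. x $ i * fst (a ! i) $ j), vec n (\<lambda>j. \<Sum>i<k. x $ i * snd (a ! i) $ j))"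

lemma lin_comb_eq_partial_comb: "lin_comb n a x = partial_comb n (length a) a x"
  by (simp add: lin_comb_def partial_comb_def)

lemma partial_comb_closed [simp]: "partial_comb n k a x \<in> phase_space n"
  by (simp add: partial_comb_def phase_space_def)

lemma partial_comb_0: "partial_comb n 0 a x = (0\<^sub>v n, 0\<^sub>v n)"
  by (auto simp: partial_comb_def)

lemma partial_comb_Suc:
  "a ! k \<in> phase_space n \<Longrightarrow> partial_comb n (Suc k) a x = partial_comb n k a x + scale_phase (x $ k) (a ! k)"
  by (auto simp: partial_comb_def scale_phase_def phase_space_def)

lemma symp_partial_comb:
  assumes "\<And>i. i < k \<Longrightarrow> a ! i \<in> phase_space n" "v \<in> phase_space n" "\<And>i. i < k \<Longrightarrow> symp (a ! i) v = 0"
  shows "symp (partial_comb n k a x) v = 0"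
  using assms
proof (induction k)
  case 0
  then show ?case by (auto simp: partial_comb_0 symp_def phase_space_def)
next
  case (Suc k)
  then show ?case
    by (simp add: partial_comb_Suc symp_add_left[of _ n] symp_scale_left[of _ n])
qed

section \<open>The module generated by pairwise orthogonal labels\<close>

locale isotropic_labels =
  fixes n :: nat and a :: "'d::finite phase_vec list"
  assumes odd_card: "odd CARD('d)"
    and label_closed: "i < length a \<Longrightarrow> a ! i \<in> phase_space n"
    and symp_labels: "i < length a \<Longrightarrow> j < length a \<Longrightarrow> symp (a ! i) (a ! j) = 0"
begin

abbreviation "M \<equiv> gen_module n a"

text \<open>Coefficients in the integers modulo \<open>d\<close> are reached by repeated addition, so a relation between
  phase space vectors and phases that is additive on commuting vectors is linear on the submodule.\<close>

lemma lin_comb_induct: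
  assumes x: "x \<in> carrier_vec (length a)" and s: "s \<in> carrier_vec (length a)"
    and zero: "Q (0\<^sub>v n, 0\<^sub>v n) 0"
    and add: "\<And>u v t t'. u \<in> phase_space n \<Longrightarrow> v \<in> phase_space n \<Longrightarrow> symp u v = 0 \<Longrightarrow>
      Q u t \<Longrightarrow> Q v t' \<Longrightarrow> Q (u + v) (t + t')"
    and base: "\<And>i. i < length a \<Longrightarrow> Q (a ! i) (s $ i)"
  shows "Q (lin_comb n a x) (x \<bullet> s)"
proof -
  have scale: "Q (scale_phase c u) (c * t)" if u: "u \<in> phase_space n" and Q: "Q u t" for c u t
  proof (induction c rule: mod_ring_unit_induct)
    case 0
    have "scale_phase 0 u = (0\<^sub>v n, 0\<^sub>v n)"
      using u by (auto simp: scale_phase_def phase_space_def)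
    then show ?case using zero by simp
  next
    case (add c)
    have "scale_phase (c + of_int_mod_ring 1) u = scale_phase c u + u"
      using u by (auto simp: scale_phase_def phase_space_def distrib_right intro!: eq_vecI)
    moreover have "symp (scale_phase c u) u = 0"
      using u by (simp add: symp_scale_left[of _ n] symp_self)
    ultimately show ?case
      using assms(4)[OF _ u _ add Q] u by (simp add: distrib_right)
  qed
  have "Q (partial_comb n k a x) (\<Sum>i<k. x $ i * s $ i)" if "k \<le> length a" for k
    using that
  proof (induction k)
    case 0
    then show ?case using zero by (simp add: partial_comb_0)
  next
    case (Suc k)
    \<comment> \<open>Additivity of \<open>Q\<close> is available on orthogonal pairs only, so the
      next label must be orthogonal to the partial sum.\<close>
    have "symp (a ! k) (partial_comb n k a x) = 0"
      using Suc.prems symp_partial_comb[of k a n "a ! k" x] symp_commute[of "a ! k" n "partial_comb n k a x"]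
      by (simp add: label_closed symp_labels)
    then have "symp (partial_comb n k a x) (scale_phase (x $ k) (a ! k)) = 0"
      using Suc.prems symp_commute[of "partial_comb n k a x" n "scale_phase (x $ k) (a ! k)"]
      by (simp add: label_closed symp_scale_left[of _ n])
    then show ?case
      using Suc add[of "partial_comb n k a x" "scale_phase (x $ k) (a ! k)"] scale base
      by (simp add: partial_comb_Suc label_closed)
  qed
  from this[of "length a"] show ?thesis
    using x s by (simp add: lin_comb_eq_partial_comb scalar_prod_def atLeast0LessThan)
qed

lemma module_subset: "u \<in> M \<Longrightarrow> u \<in> phase_space n"
  by (auto simp: gen_module_def lin_comb_eq_partial_comb)

lemma finite_module [simp]: "finite M"
  using module_subset by (intro finite_subset[OF _ finite_phase_space[of n]]) auto

lemma zero_eq_lin_comb: "(0\<^sub>v n, 0\<^sub>v n) = lin_comb n a (0\<^sub>v (length a))"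
  by (auto simp: lin_comb_def)

lemma add_lin_comb:
  "x \<in> carrier_vec (length a) \<Longrightarrow> y \<in> carrier_vec (length a) \<Longrightarrow>
    lin_comb n a x + lin_comb n a y = lin_comb n a (x + y)"
  by (auto simp: lin_comb_def sum.distrib distrib_right)

lemma uminus_lin_comb: "x \<in> carrier_vec (length a) \<Longrightarrow> - lin_comb n a x = lin_comb n a (- x)"
  by (auto simp: lin_comb_def sum_negf)

text \<open>The coefficients are the \<open>i\<close>-th unit vector, spelled out so as to make
  sense for \<open>d = 1\<close> too.\<close>

lemma label_eq_lin_comb:
  assumes "i < length a"
  shows "a ! i = lin_comb n a (vec (length a) (\<lambda>j. if j = i then of_int_mod_ring 1 else 0))"
  using label_closed[OF assms] assms
  by (auto simp: lin_comb_def phase_space_def prod_eq_iff if_distrib[of "\<lambda>c. c * _"] cong: if_cong)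

lemma module_closed:
  "(0\<^sub>v n, 0\<^sub>v n) \<in> M" "u \<in> M \<Longrightarrow> v \<in> M \<Longrightarrow> u + v \<in> M" "u \<in> M \<Longrightarrow> - u \<in> M" "i < length a \<Longrightarrow> a ! i \<in> M"
proof -
  show "(0\<^sub>v n, 0\<^sub>v n) \<in> M"
    unfolding gen_module_def zero_eq_lin_comb by (rule imageI) simp
  show "a ! i \<in> M" if "i < length a" for i
    unfolding gen_module_def label_eq_lin_comb[OF that] by (rule imageI) simp
qed (auto simp: gen_module_def add_lin_comb uminus_lin_comb)

lemma card_module_nonzero [simp]: "card M \<noteq> 0"
  using module_closed(1) by auto

text \<open>Linearity is applied in one argument at a time, with antisymmetry in between. Hence a
  map that is multiplicative on orthogonal pairs is multiplicative on the whole module.\<close>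

lemma symp_module:
  assumes "u \<in> M" "v \<in> M"
  shows "symp u v = 0"
proof -
  obtain x y where u: "u = partial_comb n (length a) a x" and v: "v = partial_comb n (length a) a y"
    using assms by (auto simp: gen_module_def lin_comb_eq_partial_comb)
  have "symp (a ! i) v = 0" if "i < length a" for i
    using that symp_partial_comb[of "length a" a n "a ! i" y] symp_commute[of "a ! i" n v]
    by (simp add: label_closed symp_labels v)
  then show ?thesis
    unfolding u by (intro symp_partial_comb) (auto simp: label_closed v)
qed

lemma sum_module_shift: "v \<in> M \<Longrightarrow> (\<Sum>u\<in>M. f (v + u)) = (\<Sum>u\<in>M. f u)"
  by (rule sum.reindex_bij_witness[of _ "\<lambda>u. - v + u" "\<lambda>u. v + u"])
    (auto simp: module_closed phase_cancel[of _ n] module_subset)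

lemma sum_module_uminus: "(\<Sum>u\<in>M. f (- u)) = (\<Sum>u\<in>M. f u)"
  by (rule sum.reindex_bij_witness[of _ uminus uminus])
    (auto simp: module_closed phase_cancel[of _ n] module_subset)

text \<open>Translation by an element \<open>v\<close> with \<open>f v \<noteq> 1\<close> permutes
  the module and multiplies the sum by \<open>f v\<close>, which forces it to be 0.\<close>

lemma sum_character:
  fixes f :: "'d phase_vec \<Rightarrow> complex"
  assumes mult: "\<And>u v. u \<in> M \<Longrightarrow> v \<in> M \<Longrightarrow> f (u + v) = f u * f v"
  shows "(\<Sum>u\<in>M. f u) = (if \<forall>u\<in>M. f u = 1 then of_nat (card M) else 0)"
proof (cases "\<forall>u\<in>M. f u = 1")
  case False
  then obtain v where v: "v \<in> M" "f v \<noteq> 1" by blast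
  have "(\<Sum>u\<in>M. f u) = f v * (\<Sum>u\<in>M. f u)"
    using sum_module_shift[OF v(1), of f] mult[OF v(1)] by (simp add: sum_distrib_left)
  then show ?thesis using v False by simp
qed simp

end

section \<open>The linear form of an outcome, and averages weighted by its character\<close>

locale isotropic_outcome = isotropic_labels n a for n and a :: "'d::finite phase_vec list" +
  fixes s :: "'d mod_ring vec"
  assumes s_carrier: "s \<in> carrier_vec (length a)"
begin

abbreviation "form \<equiv> lin_form n a s"

text \<open>Two coefficient vectors of the same element differ by a relation, on which a
  well-defined form vanishes; the definite description therefore has one solution.\<close>

lemma lin_form_lin_comb:
  assumes wd: "form_well_defined n a s" and x: "x \<in> carrier_vec (length a)"
  shows "form (lin_comb n a x) = x \<bullet> s"
  unfolding lin_form_def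
proof (rule the_equality)
  fix y assume "\<exists>x'\<in>carrier_vec (length a). lin_comb n a x = lin_comb n a x' \<and> y = x' \<bullet> s"
  then obtain x' where x': "x' \<in> carrier_vec (length a)" "lin_comb n a x = lin_comb n a x'" "y = x' \<bullet> s"
    by blast
  have "lin_comb n a (- x' + x) = - lin_comb n a x' + lin_comb n a x"
    using x x'(1) by (simp add: uminus_lin_comb add_lin_comb)
  also have "\<dots> = (0\<^sub>v n, 0\<^sub>v n)"
    using x'(2) by (simp add: phase_diff_eq_0[of _ n] lin_comb_eq_partial_comb)
  finally have "(- x' + x) \<bullet> s = 0"
    using wd x x'(1) by (simp add: form_well_defined_def)
  moreover have "(- x' + x) \<bullet> s = - (x' \<bullet> s) + x \<bullet> s"
    using x x'(1) s_carrier by (subst add_scalar_prod_distrib[of _ "length a"]) auto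
  ultimately show "y = x \<bullet> s" using x'(3) by (simp add: add_eq_0_iff)
qed (use x in blast)

lemma form_add:
  assumes "form_well_defined n a s" "u \<in> M" "v \<in> M"
  shows "form (u + v) = form u + form v"
proof -
  obtain x y where "u = lin_comb n a x" "v = lin_comb n a y" "x \<in> carrier_vec (length a)" "y \<in> carrier_vec (length a)"
    using assms by (auto simp: gen_module_def)
  then show ?thesis
    using assms(1) s_carrier
    by (simp add: add_lin_comb lin_form_lin_comb add_scalar_prod_distrib[of _ "length a"])
qed

lemma form_uminus:
  assumes "form_well_defined n a s" "u \<in> M"
  shows "form (- u) = - form u"
proof -
  obtain x where "u = lin_comb n a x" "x \<in> carrier_vec (length a)"
    using assms by (auto simp: gen_module_def)
  then show ?thesis
    using assms(1) s_carrier
    by (simp add: uminus_lin_comb lin_form_lin_comb)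
qed

lemma form_label:
  assumes "form_well_defined n a s" "i < length a"
  shows "form (a ! i) = s $ i"
proof -
  have "form (a ! i) = vec (length a) (\<lambda>j. if j = i then of_int_mod_ring 1 else 0) \<bullet> s"
    using assms lin_form_lin_comb by (subst label_eq_lin_comb) auto
  also have "\<dots> = s $ i"
    using assms(2) s_carrier by (simp add: scalar_prod_def if_distrib[of "\<lambda>c. c * _"] cong: if_cong)
  finally show ?thesis .
qed

text \<open>The coefficients common to the average of operators and the average of values, so that
  the two can be compared term by term.\<close>

definition weight :: "'d phase_vec \<Rightarrow> complex" where
  "weight u = omega_pow (- form u) / of_nat (card M)"

text \<open>If \<open>f\<close> agrees with \<open>s\<close> on the labels, it does so on the
  module, and each weight cancels the value of \<open>f\<close>. If it disagrees at a label and the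
  form is well defined, the twisted character is nontrivial there and its sum is 0. A form that is
  not well defined excludes agreement, so both sides are 0.\<close>

lemma character_average:
  assumes mult: "\<And>u v. u \<in> phase_space n \<Longrightarrow> v \<in> phase_space n \<Longrightarrow> symp u v = 0 \<Longrightarrow> f (u + v) = f u * f v"
    and nz: "f (0\<^sub>v n, 0\<^sub>v n) \<noteq> (0 :: complex)"
  shows "(if form_well_defined n a s then \<Sum>u\<in>M. weight u * f u else 0)
    = (if \<forall>i<length a. f (a ! i) = omega_pow (s $ i) then 1 else 0)"
proof (cases "\<forall>i<length a. f (a ! i) = omega_pow (s $ i)")
  case True
  have "f (0\<^sub>v n, 0\<^sub>v n) = f (0\<^sub>v n, 0\<^sub>v n) * f (0\<^sub>v n, 0\<^sub>v n)"
    using mult[of "(0\<^sub>v n, 0\<^sub>v n)" "(0\<^sub>v n, 0\<^sub>v n)"] symp_self[of "(0\<^sub>v n, 0\<^sub>v n)" n] by simp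
  then have f0: "f (0\<^sub>v n, 0\<^sub>v n) = 1" using nz by simp
  have f: "f (lin_comb n a x) = omega_pow (x \<bullet> s)" if "x \<in> carrier_vec (length a)" for x
    by (rule lin_comb_induct[where Q = "\<lambda>u t. f u = omega_pow t"])
      (use that s_carrier True f0 in \<open>auto simp: mult omega_pow_add\<close>)
  \<comment> \<open>On a relation \<open>f\<close> takes the value 1, which by faithfulness of the
    character forces \<open>x \<bullet> s = 0\<close>.\<close>
  have wd: "form_well_defined n a s"
    using f f0 unfolding form_well_defined_def by (metis omega_pow_eq_1_iff)
  have "weight u * f u = 1 / of_nat (card M)" if "u \<in> M" for u
    using that f lin_form_lin_comb[OF wd] by (auto simp: gen_module_def weight_def omega_pow_uminus)
  then show ?thesis using True wd by simp
next
  case False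
  show ?thesis
  proof (cases "form_well_defined n a s")
    case wd: True
    let ?g = "\<lambda>u. omega_pow (- form u) * f u"
    obtain i where i: "i < length a" "f (a ! i) \<noteq> omega_pow (s $ i)" using False by blast
    have "?g (a ! i) \<noteq> 1"
      using i by (simp add: form_label[OF wd] omega_pow_uminus field_simps)
    then have "(\<Sum>u\<in>M. ?g u) = 0"
      using i(1) module_closed(4)
      by (subst sum_character) (auto simp: form_add[OF wd] omega_pow_diff mult symp_module module_subset)
    then show ?thesis
      using False by (simp add: weight_def flip: sum_divide_distrib)
  qed (use False in simp)
qed

text \<open>The explicit candidate for the projector of a context. The zero matrix covers the
  outcomes that contradict a relation, whose common eigenspace is trivial.\<close>

definition stabilizer_projector :: "complex mat" where
  "stabilizer_projector =
     (if form_well_defined n a s then mat_sum (CARD('d) ^ n) M (\<lambda>u. weight u \<cdot>\<^sub>m hw u) else 0\<^sub>m (CARD('d) ^ n) (CARD('d) ^ n))"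

lemma stabilizer_projector_carrier [simp]: "stabilizer_projector \<in> carrier_mat (CARD('d) ^ n) (CARD('d) ^ n)"
  by (simp add: stabilizer_projector_def)

lemma hw_module_carrier [simp]: "u \<in> M \<Longrightarrow> hw u \<in> carrier_mat (CARD('d) ^ n) (CARD('d) ^ n)"
  by (simp add: module_subset)

lemma hw_mult_isotropic:
  fixes u v :: "'d phase_vec"
  shows "u \<in> phase_space n \<Longrightarrow> v \<in> phase_space n \<Longrightarrow> symp u v = 0 \<Longrightarrow> hw u * hw v = hw (u + v)"
  by (simp add: hw_mult[OF odd_card] half_0[OF odd_card] smult_one_mat)

definition eigenspace :: "complex vec set" where
  "eigenspace = {v \<in> carrier_vec (CARD('d) ^ n). \<forall>i<length a. hw (a ! i) *\<^sub>v v = omega_pow (s $ i) \<cdot>\<^sub>v v}"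

text \<open>Being an eigenvalue equation for \<open>v\<close> is additive on commuting pairs. The
  eigenvalue is expressed by coefficients rather than by \<open>form\<close>, because contradictory
  outcomes are treated with it as well.\<close>

lemma hw_eigenvector:
  assumes v: "v \<in> eigenspace" and x: "x \<in> carrier_vec (length a)"
  shows "hw (lin_comb n a x) *\<^sub>v v = omega_pow (x \<bullet> s) \<cdot>\<^sub>v v"
proof (rule lin_comb_induct[OF x s_carrier, where Q = "\<lambda>u t. hw u *\<^sub>v v = omega_pow t \<cdot>\<^sub>v v"])
  have vc: "v \<in> carrier_vec (CARD('d) ^ n)" using v by (simp add: eigenspace_def)
  show "hw (0\<^sub>v n, 0\<^sub>v n :: 'd mod_ring vec) *\<^sub>v v = omega_pow (0 :: 'd mod_ring) \<cdot>\<^sub>v v"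
    using vc by (simp add: hw_0[OF odd_card])
  fix u u' :: "'d phase_vec" and t t' :: "'d mod_ring"
  assume u: "u \<in> phase_space n" "u' \<in> phase_space n" "symp u u' = 0"
    and eig: "hw u *\<^sub>v v = omega_pow t \<cdot>\<^sub>v v" "hw u' *\<^sub>v v = omega_pow t' \<cdot>\<^sub>v v"
  have "hw (u + u') *\<^sub>v v = hw u *\<^sub>v (hw u' *\<^sub>v v)"
    using assoc_mult_mat_vec[OF hw_carrier[OF u(1)] hw_carrier[OF u(2)] vc] by (simp add: hw_mult_isotropic[OF u])
  also have "\<dots> = omega_pow t' \<cdot>\<^sub>v (hw u *\<^sub>v v)"
    using eig(2) mult_mat_vec[OF hw_carrier[OF u(1)] vc] by simp
  finally show "hw (u + u') *\<^sub>v v = omega_pow (t + t') \<cdot>\<^sub>v v"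
    using eig(1) by (simp add: omega_pow_add smult_smult_assoc mult.commute)
qed (use v in \<open>simp add: eigenspace_def\<close>)

text \<open>Multiplication by \<open>hw v\<close> translates the module by \<open>v\<close>, and
  translation changes all weights by one common factor.\<close>

lemma hw_mult_stabilizer_projector:
  assumes wd: "form_well_defined n a s" and v: "v \<in> M"
  shows "hw v * stabilizer_projector = omega_pow (form v) \<cdot>\<^sub>m stabilizer_projector"
proof -
  have "hw v * (weight u \<cdot>\<^sub>m hw u) = (omega_pow (form v) * weight (v + u)) \<cdot>\<^sub>m hw (v + u)" if u: "u \<in> M" for u
  proof -
    have "hw v * (weight u \<cdot>\<^sub>m hw u) = weight u \<cdot>\<^sub>m hw (v + u)"
      using u v mult_smult_distrib[OF hw_module_carrier[OF v] hw_module_carrier[OF u]]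
      by (simp add: hw_mult_isotropic module_subset symp_module)
    moreover have "weight u = omega_pow (form v) * weight (v + u)"
      using u v by (simp add: weight_def form_add[OF wd] flip: omega_pow_add)
    ultimately show ?thesis by simp
  qed
  then have "hw v * stabilizer_projector
    = mat_sum (CARD('d) ^ n) M (\<lambda>u. (omega_pow (form v) * weight (v + u)) \<cdot>\<^sub>m hw (v + u))"
    using wd v by (auto simp: stabilizer_projector_def mult_mat_sum intro!: mat_sum_eqI sum.cong)
  also have "\<dots> = mat_sum (CARD('d) ^ n) M (\<lambda>u. (omega_pow (form v) * weight u) \<cdot>\<^sub>m hw u)"
    by (rule mat_sum_eqI)
      (rule sum_module_shift[OF v, of "\<lambda>u. ((omega_pow (form v) * weight u) \<cdot>\<^sub>m hw u) $$ (_, _)"])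
  also have "\<dots> = omega_pow (form v) \<cdot>\<^sub>m stabilizer_projector"
    using wd
    by (intro eq_matI)
      (auto simp: stabilizer_projector_def sum_distrib_left mult.assoc carrier_matD[OF hw_module_carrier]
        intro!: sum.cong)
  finally show ?thesis .
qed

text \<open>Each of the \<open>card M\<close> summands acts on the projector as
  \<open>1 / card M\<close>, whence idempotence; the adjoint replaces \<open>u\<close> by
  \<open>- u\<close>, which only permutes the summands.\<close>

lemma orth_projector_stabilizer_projector: "orth_projector (CARD('d) ^ n) stabilizer_projector"
proof (cases "form_well_defined n a s")
  case wd: True
  let ?P = stabilizer_projector
  have P: "?P = mat_sum (CARD('d) ^ n) M (\<lambda>u. weight u \<cdot>\<^sub>m hw u)"
    using wd by (simp add: stabilizer_projector_def)
  have "weight u \<cdot>\<^sub>m hw u * ?P = (1 / of_nat (card M)) \<cdot>\<^sub>m ?P" if u: "u \<in> M" for u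
    using u mult_smult_assoc_mat[OF hw_module_carrier[OF u] stabilizer_projector_carrier]
    by (simp add: hw_mult_stabilizer_projector[OF wd] smult_smult_mat weight_def omega_pow_uminus)
  then have "?P * ?P = mat_sum (CARD('d) ^ n) M (\<lambda>u. (1 / of_nat (card M)) \<cdot>\<^sub>m ?P)"
    by (subst (1) P) (auto simp: mat_sum_mult intro!: mat_sum_eqI sum.cong)
  also have "\<dots> = ?P"
    by (intro eq_matI) (auto simp: carrier_matD[OF stabilizer_projector_carrier])
  finally have "?P * ?P = ?P" .
  moreover have "mat_adjoint ?P = ?P"
  proof -
    have "mat_adjoint (weight u \<cdot>\<^sub>m hw u) = weight (- u) \<cdot>\<^sub>m hw (- u)" if "u \<in> M" for u
      using that
      by (simp add: mat_adjoint_smult mat_adjoint_hw[OF odd_card module_subset] weight_def cnj_omega_pow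
          form_uminus[OF wd])
    then have "mat_adjoint ?P = mat_sum (CARD('d) ^ n) M (\<lambda>u. weight (- u) \<cdot>\<^sub>m hw (- u))"
      unfolding P by (subst mat_adjoint_mat_sum) (auto intro!: mat_sum_eqI sum.cong)
    also have "\<dots> = ?P"
      unfolding P
      by (rule mat_sum_eqI) (rule sum_module_uminus[of "\<lambda>u. (weight u \<cdot>\<^sub>m hw u) $$ (_, _)"])
    finally show ?thesis .
  qed
  ultimately show ?thesis by (simp add: orth_projector_def)
next
  case False
  then show ?thesis
    by (auto simp: orth_projector_def stabilizer_projector_def mat_adjoint_index)
qed

text \<open>Vectors in the image are eigenvectors because \<open>hw (a ! i)\<close> acts on the
  projector by a scalar. Conversely, on an eigenvector each summand is multiplication by
  \<open>1 / card M\<close>, so the projector fixes it.\<close>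

lemma projector_onto_eigenspace: "projector_onto (CARD('d) ^ n) eigenspace = stabilizer_projector"
proof (rule projector_onto_eqI[OF orth_projector_stabilizer_projector])
  let ?P = stabilizer_projector
  show "(\<lambda>v. ?P *\<^sub>v v) ` carrier_vec (CARD('d) ^ n) = eigenspace"
  proof (cases "form_well_defined n a s")
    case wd: True
    have "?P *\<^sub>v v \<in> eigenspace" if v: "v \<in> carrier_vec (CARD('d) ^ n)" for v
    proof -
      have "hw (a ! i) *\<^sub>v (?P *\<^sub>v v) = omega_pow (s $ i) \<cdot>\<^sub>v (?P *\<^sub>v v)" if i: "i < length a" for i
      proof -
        note ai = module_closed(4)[OF i]
        have "hw (a ! i) *\<^sub>v (?P *\<^sub>v v) = (omega_pow (s $ i) \<cdot>\<^sub>m ?P) *\<^sub>v v"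
          using assoc_mult_mat_vec[OF hw_module_carrier[OF ai] stabilizer_projector_carrier v] i
          by (simp add: hw_mult_stabilizer_projector[OF wd ai] form_label[OF wd])
        then show ?thesis
          using v stabilizer_projector_carrier by (auto simp: smult_mat_mult_vec)
      qed
      then show ?thesis
        using mult_mat_vec_carrier[OF stabilizer_projector_carrier v] by (simp add: eigenspace_def)
    qed
    moreover have "v \<in> (\<lambda>v. ?P *\<^sub>v v) ` carrier_vec (CARD('d) ^ n)" if v: "v \<in> eigenspace" for v
    proof -
      have vc: "v \<in> carrier_vec (CARD('d) ^ n)" using v by (simp add: eigenspace_def)
      have "(?P *\<^sub>v v) $ i = v $ i" if i: "i < (CARD('d) ^ n)" for i
      proof -
        have "((weight u \<cdot>\<^sub>m hw u) *\<^sub>v v) $ i = v $ i / of_nat (card M)" if u: "u \<in> M" for u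
        proof -
          have "hw u *\<^sub>v v = omega_pow (form u) \<cdot>\<^sub>v v"
            using u hw_eigenvector[OF v] by (auto simp: gen_module_def lin_form_lin_comb[OF wd])
          then show ?thesis
            using i vc smult_mat_mult_vec[OF hw_module_carrier[OF u] vc]
            by (simp add: weight_def omega_pow_uminus)
        qed
        then show ?thesis
          using wd i vc by (simp add: stabilizer_projector_def mat_sum_mult_vec del: index_mult_mat_vec)
      qed
      then have "?P *\<^sub>v v = v"
        using vc by (intro eq_vecI) (auto simp: carrier_matD[OF stabilizer_projector_carrier])
      then show ?thesis using vc by (metis image_eqI)
    qed
    ultimately show ?thesis by blast
  next
    case False
    then obtain x where x: "x \<in> carrier_vec (length a)" "lin_comb n a x = (0\<^sub>v n, 0\<^sub>v n)" "x \<bullet> s \<noteq> 0"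
      by (auto simp: form_well_defined_def)
    have "v = 0\<^sub>v (CARD('d) ^ n)" if v: "v \<in> eigenspace" for v
    proof (rule eq_vecI)
      have vc: "v \<in> carrier_vec (CARD('d) ^ n)" using v by (simp add: eigenspace_def)
      then show "dim_vec v = dim_vec (0\<^sub>v (CARD('d) ^ n))" by simp
      \<comment> \<open>The violated relation expresses the identity operator through the labels, so
        \<open>v\<close> is multiplied by a phase different from 1 and must vanish.\<close>
      have eq: "v = omega_pow (x \<bullet> s) \<cdot>\<^sub>v v"
        using hw_eigenvector[OF v x(1)] vc by (simp add: x(2) hw_0[OF odd_card])
      fix i assume "i < dim_vec (0\<^sub>v (CARD('d) ^ n))"
      then have "v $ i = omega_pow (x \<bullet> s) * v $ i"
        using vc arg_cong[OF eq, of "\<lambda>w. w $ i"] by simp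
      then show "v $ i = 0\<^sub>v (CARD('d) ^ n) $ i"
        using x(3) \<open>i < dim_vec (0\<^sub>v (CARD('d) ^ n))\<close> by simp
    qed
    moreover have "hw (a ! i) *\<^sub>v 0\<^sub>v (CARD('d) ^ n) = 0\<^sub>v (CARD('d) ^ n)" if "i < length a" for i
      using hw_carrier[OF label_closed[OF that]] by (intro eq_vecI) auto
    then have "0\<^sub>v (CARD('d) ^ n) \<in> eigenspace"
      by (auto simp: eigenspace_def)
    ultimately have "eigenspace = {0\<^sub>v (CARD('d) ^ n)}" by blast
    moreover have "?P *\<^sub>v v = 0\<^sub>v (CARD('d) ^ n)" if "v \<in> carrier_vec (CARD('d) ^ n)" for v
      using False that by (intro eq_vecI) (auto simp: stabilizer_projector_def)
    then have "(\<lambda>v. ?P *\<^sub>v v) ` carrier_vec (CARD('d) ^ n) = {0\<^sub>v (CARD('d) ^ n)}"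
      by (simp add: image_constant[OF zero_carrier_vec] cong: image_cong)
    ultimately show ?thesis by simp
  qed
qed

text \<open>This order of the factors occurs in the functional on matrices; the opposite order,
  treated next, occurs in the Born rule.\<close>

lemma mat_trace_mult_stabilizer_projector:
  assumes B: "B \<in> carrier_mat (CARD('d) ^ n) (CARD('d) ^ n)"
  shows "mat_trace (B * stabilizer_projector)
    = (if form_well_defined n a s then \<Sum>u\<in>M. weight u * mat_trace (B * hw u) else 0)"
proof (cases "form_well_defined n a s")
  case True
  then show ?thesis
    using B mult_smult_distrib[OF B hw_module_carrier] mat_trace_smult[OF mult_carrier_mat[OF B hw_module_carrier]]
    by (simp add: stabilizer_projector_def mult_mat_sum mat_trace_mat_sum)
next
  case False
  then show ?thesis
    using B by (simp add: stabilizer_projector_def mat_trace_def)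
qed

lemma mat_trace_stabilizer_projector_mult:
  assumes B: "B \<in> carrier_mat (CARD('d) ^ n) (CARD('d) ^ n)"
  shows "mat_trace (stabilizer_projector * B)
    = (if form_well_defined n a s then \<Sum>u\<in>M. weight u * mat_trace (hw u * B) else 0)"
proof (cases "form_well_defined n a s")
  case True
  then show ?thesis
    using B mult_smult_assoc_mat[OF hw_module_carrier B] mat_trace_smult[OF mult_carrier_mat[OF hw_module_carrier B]]
    by (simp add: stabilizer_projector_def mat_sum_mult mat_trace_mat_sum mult_carrier_mat[OF _ B])
next
  case False
  then show ?thesis
    using B by (simp add: stabilizer_projector_def mat_trace_def)
qed

end

section \<open>Value assignments as linear functionals\<close>

text \<open>Both products are multiples of \<open>hw (u + v)\<close>. Multiplying by its inverse
  \<open>hw (- (u + v))\<close> leaves two multiples of the identity, whose phases must agree; then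
  \<open>symp u v\<close> equals its own negative.\<close>

lemma symp_zero_if_hw_commute:
  assumes odd: "odd CARD('d::finite)" and u: "u \<in> phase_space n" and v: "v \<in> phase_space n"
    and comm: "hw u * hw v = hw v * hw (u :: 'd phase_vec)"
  shows "symp u v = 0"
proof -
  let ?N = "CARD('d) ^ n"
  have uv: "u + v \<in> phase_space n" "- (u + v) \<in> phase_space n" using u v by auto
  have vu: "v + u = u + v"
    using u v comm_add_vec by (auto simp: phase_space_def)
  have "hw u * hw v * hw (- (u + v)) = hw v * hw u * hw (- (u + v))" using comm by simp
  moreover have "hw x * hw y * hw (- (u + v)) = omega_pow (half (symp x y)) \<cdot>\<^sub>m 1\<^sub>m ?N"
    if x: "x \<in> phase_space n" and y: "y \<in> phase_space n" and xy: "x + y = u + v" for x y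
  proof -
    have s: "symp (u + v) (- (u + v)) = 0"
      by (rule symp_uminus_self[OF uv(1)])
    have z: "u + v + - (u + v) = (0\<^sub>v n, 0\<^sub>v n)"
      using uv(1) by (auto simp: phase_space_def)
    have "hw x * hw y * hw (- (u + v)) = omega_pow (half (symp x y)) \<cdot>\<^sub>m (hw (u + v) * hw (- (u + v)))"
      using mult_smult_assoc_mat[OF hw_carrier[OF uv(1)] hw_carrier[OF uv(2)]]
      by (simp only: hw_mult[OF odd x y] xy)
    also have "hw (u + v) * hw (- (u + v)) = 1\<^sub>m ?N"
      by (simp only: hw_mult[OF odd uv] s z hw_0[OF odd] half_0[OF odd] omega_pow_0 smult_one_mat)
    finally show ?thesis .
  qed
  ultimately have "omega_pow (half (symp u v)) \<cdot>\<^sub>m 1\<^sub>m ?N = omega_pow (half (symp v u)) \<cdot>\<^sub>m (1\<^sub>m ?N :: complex mat)"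
    using u v vu by metis
  \<comment> \<open>The entry at \<open>(0, 0)\<close> exists because the dimension is positive,
    even for \<open>n = 0\<close>.\<close>
  then have "(omega_pow (half (symp u v)) \<cdot>\<^sub>m 1\<^sub>m ?N) $$ (0, 0)
    = (omega_pow (half (symp v u)) \<cdot>\<^sub>m (1\<^sub>m ?N :: complex mat)) $$ (0, 0)"
    by simp
  then have "half (symp u v) = half (symp v u)"
    by simp
  then have "symp u v = symp v u"
    using half_add_half(1)[OF odd] by metis
  then have "symp u v + symp u v = 0"
    using symp_commute[OF u v] by (metis left_minus)
  then show ?thesis by (rule double_eq_0_mod_ring[OF odd])
qed

text \<open>Labels are chosen preimages under \<open>hw\<close>, so they map back to the operators
  of the context, and commutation becomes orthogonality.\<close>

lemma context_labels:
  assumes odd: "odd CARD('d::finite)" and C: "C \<in> contexts TYPE('d) n"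
  shows "isotropic_labels n (labels n C :: 'd phase_vec list)" (is "isotropic_labels n ?a")
    and "i < length C \<Longrightarrow> hw (labels n C ! i :: 'd phase_vec) = C ! i"
proof -
  have lab: "?a ! i \<in> phase_space n" "hw (?a ! i) = C ! i" if "i < length C" for i
  proof -
    have "C ! i \<in> hw ` (phase_space n :: 'd phase_vec set)"
      using C that nth_mem by (fastforce simp: contexts_def)
    then show "?a ! i \<in> phase_space n" "hw (?a ! i) = C ! i"
      using that by (auto simp: labels_def inv_into_into f_inv_into_f simp del: imageE)
  qed
  then show "i < length C \<Longrightarrow> hw (?a ! i) = C ! i" by blast
  show "isotropic_labels n ?a"
  proof
    show "odd CARD('d)" by (fact odd)
    fix i j assume i: "i < length ?a"
    then show "?a ! i \<in> phase_space n" using lab by (simp add: labels_def)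
    assume j: "j < length ?a"
    have "C ! i * C ! j = C ! j * C ! i"
      using C i j by (simp add: contexts_def labels_def)
    then show "symp (?a ! i) (?a ! j) = 0"
      using i j lab by (intro symp_zero_if_hw_commute[OF odd]) (auto simp: labels_def)
  qed
qed

section \<open>The model defined by a value assignment\<close>

locale nc_assignment =
  fixes n :: nat and \<rho> :: "complex mat" and S :: "'s set" and q :: "'s \<Rightarrow> real"
    and lam :: "'s \<Rightarrow> 'd::finite phase_vec \<Rightarrow> complex"
  assumes odd_card: "odd CARD('d)"
    and density: "density_matrix (CARD('d) ^ n) \<rho>"
    and nc: "nc_value_assignments n \<rho> S q lam"
begin

abbreviation "cond \<equiv> assignment_family n lam"

lemma finite_hidden [simp]: "finite S"
  and prob_hidden: "prob_dist S q"
  and lam_range: "\<nu> \<in> S \<Longrightarrow> u \<in> phase_space n \<Longrightarrow> lam \<nu> u \<in> range (omega_pow :: 'd mod_ring \<Rightarrow> complex)"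
  and lam_add: "\<nu> \<in> S \<Longrightarrow> u \<in> phase_space n \<Longrightarrow> v \<in> phase_space n \<Longrightarrow> symp u v = 0 \<Longrightarrow>
    lam \<nu> (u + v) = lam \<nu> u * lam \<nu> v"
  and trace_hw_density: "u \<in> phase_space n \<Longrightarrow> mat_trace (hw u * \<rho>) = (\<Sum>\<nu>\<in>S. lam \<nu> u * of_real (q \<nu>))"
  using nc by (auto simp: nc_value_assignments_def)

lemma outcome_locale:
  assumes "C \<in> contexts TYPE('d) n" and "s \<in> carrier_vec (length C)"
  shows "isotropic_outcome n (labels n C :: 'd phase_vec list) s"
  using assms context_labels(1)[OF odd_card assms(1)]
  by (simp add: isotropic_outcome_def isotropic_outcome_axioms_def labels_def)

lemma cond_eq_weighted_sum:
  assumes "C \<in> contexts TYPE('d) n" and "s \<in> carrier_vec (length C)"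
  shows "cond C s \<nu> = (if form_well_defined n (labels n C) s
    then \<Sum>u\<in>gen_module n (labels n C). isotropic_outcome.weight n (labels n C) s u * lam \<nu> u else 0)"
  by (simp add: assignment_family_def Let_def isotropic_outcome.weight_def[OF outcome_locale[OF assms]]
      flip: sum_divide_distrib)

lemma context_projector_eq:
  fixes s :: "'d mod_ring vec"
  assumes C: "C \<in> contexts TYPE('d) n" and s: "s \<in> carrier_vec (length C)"
  shows "context_projector n C s = isotropic_outcome.stabilizer_projector n (labels n C) s"
proof -
  interpret isotropic_outcome n "labels n C" s by (rule outcome_locale[OF C s])
  have "length (labels n C :: 'd phase_vec list) = length C" by (simp add: labels_def)
  then show ?thesis
    using context_labels(2)[OF odd_card C] projector_onto_eigenspace
    by (simp add: context_projector_def eigenspace_def cong: conj_cong)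
qed

text \<open>The predetermined outcome: discrete logarithms of the values at the labels, unique since
  values are powers of omega and \<open>omega_pow\<close> is injective.\<close>

definition outcome :: "'s \<Rightarrow> complex mat list \<Rightarrow> 'd mod_ring vec" where
  "outcome \<nu> C = vec (length C) (\<lambda>i. inv_into UNIV omega_pow (lam \<nu> (labels n C ! i)))"

text \<open>An instance of \<open>character_average\<close> with \<open>f\<close> taken as
  \<open>lam \<nu>\<close>; its value at the origin is nonzero, being a power of omega.\<close>

lemma cond_deterministic:
  assumes C: "C \<in> contexts TYPE('d) n" and s: "s \<in> carrier_vec (length C)" and \<nu>: "\<nu> \<in> S"
  shows "cond C s \<nu> = (if outcome \<nu> C = s then 1 else 0)"
proof -
  interpret isotropic_outcome n "labels n C" s by (rule outcome_locale[OF C s])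
  have len: "length (labels n C :: 'd phase_vec list) = length C" by (simp add: labels_def)
  have "lam \<nu> (0\<^sub>v n, 0\<^sub>v n) \<in> range (omega_pow :: 'd mod_ring \<Rightarrow> complex)"
    by (intro lam_range \<nu>) simp
  then have lam0: "lam \<nu> (0\<^sub>v n, 0\<^sub>v n) \<noteq> 0" by auto
  have "cond C s \<nu> = (if \<forall>i<length C. lam \<nu> (labels n C ! i) = omega_pow (s $ i) then 1 else 0)"
    by (subst cond_eq_weighted_sum[OF C s], subst character_average) (auto simp: lam_add[OF \<nu>] lam0 len)
  moreover have "lam \<nu> (labels n C ! i) = omega_pow (outcome \<nu> C $ i)" if "i < length C" for i
    using that lam_range[OF \<nu> label_closed, of i] by (simp add: outcome_def len f_inv_into_f)
  then have "(\<forall>i<length C. lam \<nu> (labels n C ! i) = omega_pow (s $ i)) \<longleftrightarrow> outcome \<nu> C = s"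
    using s by (auto simp: outcome_def intro!: eq_vecI)
  ultimately show ?thesis by simp
qed

lemma outcome_carrier [simp]: "outcome \<nu> C \<in> carrier_vec (length C)"
  by (simp add: outcome_def)

lemma deterministic_cond: "deterministic n S cond"
  unfolding deterministic_def
proof
  fix \<nu> assume "\<nu> \<in> S"
  then show "\<exists>\<alpha>. \<forall>C\<in>contexts TYPE('d) n. \<alpha> C \<in> carrier_vec (length C) \<and>
      (\<forall>s\<in>carrier_vec (length C). cond C s \<nu> = (if \<alpha> C = s then 1 else 0))"
    by (intro exI[of _ "outcome \<nu>"]) (auto simp: cond_deterministic)
qed

lemma hvm_cond: "hvm n \<rho> S q cond"
  unfolding hvm_def
proof (intro conjI ballI)
  show "prob_dist S q" by (rule prob_hidden)
next
  fix C \<nu> and s :: "'d mod_ring vec" assume "C \<in> contexts TYPE('d) n" "\<nu> \<in> S" "s \<in> carrier_vec (length C)"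
  then show "cond C s \<nu> \<in> \<real>" by (simp add: cond_deterministic)
next
  fix C \<nu> assume C: "C \<in> contexts TYPE('d) n" and \<nu>: "\<nu> \<in> S"
  let ?A = "carrier_vec (length C) :: 'd mod_ring vec set"
  have "(\<Sum>s\<in>?A. Re (cond C s \<nu>)) = (\<Sum>s\<in>?A. if outcome \<nu> C = s then 1 else 0)"
    by (intro sum.cong) (auto simp: cond_deterministic[OF C _ \<nu>])
  also have "\<dots> = 1" by simp
  finally have "((\<lambda>s. Re (cond C s \<nu>)) has_sum 1) ?A"
    using has_sum_finite[of ?A "\<lambda>s. Re (cond C s \<nu>)"] by simp
  then show "prob_dist ?A (\<lambda>s. Re (cond C s \<nu>))"
    by (simp add: prob_dist_def cond_deterministic[OF C _ \<nu>])
next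
  fix C and s :: "'d mod_ring vec" assume C: "C \<in> contexts TYPE('d) n" and s: "s \<in> carrier_vec (length C)"
  interpret isotropic_outcome n "labels n C" s by (rule outcome_locale[OF C s])
  have \<rho>: "\<rho> \<in> carrier_mat (CARD('d) ^ n) (CARD('d) ^ n)"
    using density by (simp add: density_matrix_def)
  \<comment> \<open>Both sides expand with the same weights over the same module, and condition (2)
    on value assignments matches them at each \<open>u\<close>; if the form is not well defined,
    both are 0.\<close>
  have "(\<Sum>\<nu>\<in>S. cond C s \<nu> * of_real (q \<nu>)) = mat_trace (context_projector n C s * \<rho>)"
    unfolding context_projector_eq[OF C s] mat_trace_stabilizer_projector_mult[OF \<rho>] cond_eq_weighted_sum[OF C s]
    by (simp add: trace_hw_density[OF module_subset] sum_distrib_left sum_distrib_right mult.assoc sum.swap[of _ S])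
  then show "((\<lambda>\<nu>. cond C s \<nu> * of_real (q \<nu>)) has_sum mat_trace (context_projector n C s * \<rho>)) S"
    using has_sum_finite[OF finite_hidden, of "\<lambda>\<nu>. cond C s \<nu> * of_real (q \<nu>)"] by simp
qed

text \<open>By trace orthogonality of the Heisenberg-Weyl operators this is the linear functional sending each
  \<open>hw u\<close> to \<open>lam \<nu> u\<close>.\<close>

definition assignment_functional :: "'s \<Rightarrow> complex mat \<Rightarrow> complex" where
  "assignment_functional \<nu> A =
     (\<Sum>w\<in>phase_space n. lam \<nu> w * mat_trace (hw (- w) * A)) / of_nat (CARD('d) ^ n)"

lemma assignment_functional_mat_sum:
  assumes "\<And>x. x \<in> F \<Longrightarrow> f x \<in> carrier_mat (CARD('d) ^ n) (CARD('d) ^ n)"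
  shows "assignment_functional \<nu> (mat_sum (CARD('d) ^ n) F f) = (\<Sum>x\<in>F. assignment_functional \<nu> (f x))"
proof -
  have "mat_trace (hw (- w) * mat_sum (CARD('d) ^ n) F f) = (\<Sum>x\<in>F. mat_trace (hw (- w) * f x))"
    if w: "w \<in> phase_space n" for w :: "'d phase_vec"
  proof -
    have c: "hw (- w) \<in> carrier_mat (CARD('d) ^ n) (CARD('d) ^ n)" using w by simp
    have "hw (- w) * mat_sum (CARD('d) ^ n) F f = mat_sum (CARD('d) ^ n) F (\<lambda>x. hw (- w) * f x)"
      by (rule mult_mat_sum[OF c]) (rule assms)
    then show ?thesis
      using mat_trace_mat_sum[of F "\<lambda>x. hw (- w) * f x"] mult_carrier_mat[OF c assms] by simp
  qed
  then show ?thesis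
    by (simp add: assignment_functional_def sum_distrib_left sum.swap[of _ F] flip: sum_divide_distrib)
qed

text \<open>\<open>hw (- w)\<close> is the adjoint of \<open>hw w\<close>, so this is the
  Hilbert-Schmidt inner product. It is a phase times the trace of \<open>hw (- w + u)\<close>, and
  the phase is trivial when \<open>w = u\<close>.\<close>

lemma mat_trace_hw_orthogonal:
  fixes w u :: "'d phase_vec"
  assumes w: "w \<in> phase_space n" and u: "u \<in> phase_space n"
  shows "mat_trace (hw (- w) * hw u) = (if w = u then of_nat (CARD('d) ^ n) else (0 :: complex))"
proof -
  have w': "- w \<in> phase_space n" using w by simp
  then have wu: "- w + u \<in> phase_space n" using u by simp
  have "mat_trace (hw (- w) * hw u) = omega_pow (half (symp (- w) u)) * mat_trace (hw (- w + u))"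
    unfolding hw_mult[OF odd_card w' u] by (rule mat_trace_smult[OF hw_carrier[OF wu]])
  moreover have "symp (- u) u = 0"
    by (rule symp_uminus_self[OF u])
  ultimately show ?thesis
    using mat_trace_hw[OF odd_card wu] phase_diff_eq_0[OF w u] by (auto simp: half_0[OF odd_card])
qed

lemma assignment_functional_context_projector:
  assumes C: "C \<in> contexts TYPE('d) n" and s: "s \<in> carrier_vec (length C)"
  shows "assignment_functional \<nu> (context_projector n C s) = cond C s \<nu>"
proof -
  interpret isotropic_outcome n "labels n C" s by (rule outcome_locale[OF C s])
  let ?N = "of_nat (CARD('d) ^ n) :: complex"
  have tr: "mat_trace (hw (- w) * stabilizer_projector)
      = (if form_well_defined n (labels n C) s then \<Sum>u\<in>M. weight u * (if w = u then ?N else 0) else 0)"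
    if "w \<in> phase_space n" for w :: "'d phase_vec"
    using that by (simp add: mat_trace_mult_stabilizer_projector mat_trace_hw_orthogonal module_subset)
  \<comment> \<open>After exchanging the sums, orthogonality retains the term \<open>w = u\<close>,
    and its factor \<open>d^n\<close> cancels the normalisation of the functional.\<close>
  have "(\<Sum>w\<in>phase_space n. lam \<nu> w * (\<Sum>u\<in>M. weight u * (if w = u then ?N else 0)))
      = (\<Sum>u\<in>M. \<Sum>w\<in>phase_space n. if w = u then lam \<nu> u * weight u * ?N else 0)"
    unfolding sum_distrib_left by (subst sum.swap) (intro sum.cong refl, auto)
  also have "\<dots> = (\<Sum>u\<in>M. weight u * lam \<nu> u) * ?N"
    unfolding sum_distrib_right by (intro sum.cong) (auto simp: module_subset)
  finally show ?thesis
    unfolding context_projector_eq[OF C s] cond_eq_weighted_sum[OF C s] assignment_functional_def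
    by (simp add: tr)
qed

lemma non_contextual_cond: "non_contextual TYPE('o) n S cond"
proof -
  \<comment> \<open>The right-hand side depends on \<open>\<nu>\<close> and the matrix
    \<open>P r\<close> alone, so two implementations sharing a projector give equal sums.\<close>
  have eq: "(\<Sum>t\<in>fiber (length C) \<sigma> r. cond C t \<nu>) = assignment_functional \<nu> (P r)"
    if "implementation n Out P C \<sigma>" "r \<in> Out" for Out :: "'o set" and P C r \<nu> and \<sigma> :: "'d mod_ring vec \<Rightarrow> 'o"
  proof -
    have C: "C \<in> contexts TYPE('d) n"
      and P: "P r = mat_sum (CARD('d) ^ n) (fiber (length C) \<sigma> r) (context_projector n C)"
      using that by (auto simp: implementation_def)
    have "context_projector n C t \<in> carrier_mat (CARD('d) ^ n) (CARD('d) ^ n)"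
      if "t \<in> fiber (length C) \<sigma> r" for t
      using that isotropic_outcome.stabilizer_projector_carrier[OF outcome_locale[OF C]]
      by (simp add: fiber_def context_projector_eq[OF C])
    then have "assignment_functional \<nu> (P r)
      = (\<Sum>t\<in>fiber (length C) \<sigma> r. assignment_functional \<nu> (context_projector n C t))"
      unfolding P by (rule assignment_functional_mat_sum)
    also have "\<dots> = (\<Sum>t\<in>fiber (length C) \<sigma> r. cond C t \<nu>)"
      by (intro sum.cong refl assignment_functional_context_projector[OF C]) (simp add: fiber_def)
    finally show ?thesis by simp
  qed
  show ?thesis
    unfolding non_contextual_def by (metis eq)
qed

end

theorem proposition2:
  fixes n :: nat and \<rho> :: "complex mat" and S :: "'s set" and q :: "'s \<Rightarrow> real"
    and lam :: "'s \<Rightarrow> 'd::finite phase_vec \<Rightarrow> complex"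
  assumes "odd CARD('d)"
    and "density_matrix (CARD('d) ^ n) \<rho>"
    and "nc_value_assignments n \<rho> S q lam"
  shows "hvm n \<rho> S q (assignment_family n lam) \<and>
    deterministic n S (assignment_family n lam) \<and>
    non_contextual TYPE('o) n S (assignment_family n lam)"
proof -
  interpret nc_assignment n \<rho> S q lam using assms by unfold_locales
  show ?thesis using hvm_cond deterministic_cond non_contextual_cond by blast
qed

end
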